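(* Let $A,B>0$, $k\in\mathbb R\setminus\{0\}$, and let $\chi_0$ be a (necessarily real) triple spatial root, $F(\chi;\mu_0)=\mu_0(\chi-\chi_0)^3$, with $\lambda_0=\sqrt{\mu_0}>0$ (see context). Let $M_1,M_2\in\mathbb C$ satisfy the null constraint $$g_{11}|M_1|^2+g_{02}\operatorname{Re}M_2+\operatorname{Re}\left(g_{12}M_1^*M_2\right)+\frac{g_{22}}{4}|M_2|^2=0,$$ and let $$\mathbf y_R=\mathbf Y_0+M_1\mathbf Y_1+\frac{M_2}{2}\mathbf Y_2,\qquad \mathbf y_\mu=\frac1{2\lambda_0}\begin{pmatrix} E_0+M_1E_1+\frac{M_2}{2}E_2 \\ 0 \\ 0 \end{pmatrix}+\frac{\mathcal M_3}{6}\mathbf Y_3+\frac{\mathcal M_4}{24}\mathbf Y_4+\frac{\mathcal M_5}{120}\mathbf Y_5 .$$ For $\zeta\in\mathbb C\setminus\mathbb R$ define $$m_\zeta^{(3)}=\frac{2\lambda_0}{\zeta^*-\zeta}\Big[\zeta^*\langle\mathbf y_\mu|J|\mathbf y_R\rangle+\zeta\langle\mathbf y_R|J|\mathbf y_\mu\rangle\Big]-\frac{\langle\mathbf y_R|K|\mathbf y_R\rangle}{2\lambda_0},$$ and, writing $\mathbf y_R=(\psi_R,\phi_R,\varphi_R)^{\mathsf T}$, $$\begin{pmatrix} u_1^{(R,3;\zeta)} \\ u_2^{(R,3;\zeta)} \end{pmatrix}=\begin{pmatrix} u_{1,0} \\ u_{2,0} \end{pmatrix}+\frac{2\psi_R^*}{m_\zeta^{(3)}}\begin{pmatrix}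 \phi_R \\ \varphi_R \end{pmatrix}.$$ Then $$\operatorname{Re}m_\zeta^{(3)}=-\frac{\langle\mathbf y_R|\mathbf y_R\rangle}{2\lambda_0}<0 .$$ Consequently $(u_1^{(R,3;\zeta)},u_2^{(R,3;\zeta)})$ is a globally nonsingular exact solution of the coupled Fokas--Lenells system.
   Context: Coupled Fokas--Lenells system for complex functions $u_1,u_2$ of $(x,t)\in\mathbb R^2$: $$u_{1,xt}+u_1+\mathrm i\big(|u_1|^2+\tfrac12|u_2|^2\big)u_{1,x}+\tfrac{\mathrm i}{2}u_1u_2^*u_{2,x}=0,\qquad u_{2,xt}+u_2+\mathrm i\big(|u_2|^2+\tfrac12|u_1|^2\big)u_{2,x}+\tfrac{\mathrm i}{2}u_2u_1^*u_{1,x}=0.$$ $S=A+B$, $R=A-B$; $a_1,a_2\in\mathbb R$ with $a_1^2=A$, $a_2^2=B$; $k_1=k$, $k_2=-k$; $\omega_1=1/k-A$, $\omega_2=-1/k-B$; $u_{j,0}=a_j\exp[\mathrm i(k_jx+\omega_jt)]$. $F(\chi;\mu)=\mu\chi^3-2\chi^2+k^2(S-\mu)\chi+k^2(2-kR)$. At a triple root one has automatically $\chi_0\in\mathbb R$, $0<\chi_0<|k|$, $\mu_0=\frac{2}{3\chi_0}>0$. $\nu(\chi)=\frac S2+\frac{2-kR}{2\chi}$, $E(\chi)=\exp[\mathrm i(\chi x+\nu(\chi)t)]$, $h_1(\chi)=\frac{k}{k+\chi}$, $h_2(\chi)=\frac{k}{k-\chi}$, $\mathbf y(\chi,\lambda)=(\lambda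 E(\chi),u_{1,0}h_1(\chi)E(\chi),u_{2,0}h_2(\chi)E(\chi))^{\mathsf T}$, $\mathbf Y_n=\partial_\chi^n\mathbf y(\chi,\lambda_0)|_{\chi=\chi_0}$ (at fixed $\lambda_0$), $E_n=\partial_\chi^nE(\chi)|_{\chi=\chi_0}$. $D_0=\chi_0^3-k^2\chi_0$, $D_1=3\chi_0^2-k^2$, and $$\mathcal M_3=-\frac{3\chi_0M_2+D_1M_1+D_0}{\mu_0},\qquad \mathcal M_4=-\frac{D_1M_2+D_0M_1}{\mu_0},\qquad \mathcal M_5=-\frac{D_0M_2}{\mu_0}.$$ $J=\operatorname{diag}(1,-1,-1)$, $K=I_3$, $\langle\mathbf f|M|\mathbf g\rangle=\mathbf f^\dagger M\mathbf g$, $\langle\mathbf f|\mathbf g\rangle=\mathbf f^\dagger\mathbf g$, $g_{mn}=\langle\mathbf Y_m|J|\mathbf Y_n\rangle$ ($0\le m,n\le2$), which are real constants independent of $(x,t)$. $^*$ is complex conjugation. *)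

theory Defs
  imports "HOL-Analysis.Analysis"
begin

section \<open>Partial derivatives and the coupled Fokas--Lenells system\<close>

text \<open>Fields on the plane are curried functions of \<open>x\<close> and \<open>t\<close>.\<close>

definition partial_x :: "(real \<Rightarrow> real \<Rightarrow> complex) \<Rightarrow> real \<Rightarrow> real \<Rightarrow> complex" where
  "partial_x u x t = vector_derivative (\<lambda>s. u s t) (at x)"

definition partial_t :: "(real \<Rightarrow> real \<Rightarrow> complex) \<Rightarrow> real \<Rightarrow> real \<Rightarrow> complex" where
  "partial_t u x t = vector_derivative (\<lambda>s. u x s) (at t)"

inductive_set iterated_partials ::
    "(real \<Rightarrow> real \<Rightarrow> complex) \<Rightarrow> (real \<Rightarrow> real \<Rightarrow> complex) set"
  for u where
  self: "u \<in> iterated_partials u"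
| dx: "v \<in> iterated_partials u \<Longrightarrow> partial_x v \<in> iterated_partials u"
| dt: "v \<in> iterated_partials u \<Longrightarrow> partial_t v \<in> iterated_partials u"

text \<open>\<open>C\<^sup>\<infinity>\<close> on the whole plane. Since \<^const>\<open>vector_derivative\<close> is total,
  existence of every partial derivative has to be required explicitly.\<close>

definition smooth_on_plane :: "(real \<Rightarrow> real \<Rightarrow> complex) \<Rightarrow> bool" where
  "smooth_on_plane u \<longleftrightarrow>
    (\<forall>v \<in> iterated_partials u.
       continuous_on UNIV (\<lambda>(x, t). v x t) \<and>
       (\<forall>x t. (\<lambda>s. v s t) differentiable (at x) \<and> (\<lambda>s. v x s) differentiable (at t)))"

definition coupled_FL_solution ::
    "(real \<Rightarrow> real \<Rightarrow> complex) \<Rightarrow> (real \<Rightarrow> real \<Rightarrow> complex) \<Rightarrow> bool" where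
  "coupled_FL_solution u1 u2 \<longleftrightarrow>
    (\<forall>x t.
       (\<lambda>s. u1 s t) differentiable (at x) \<and> (\<lambda>s. u2 s t) differentiable (at x) \<and>
       (\<lambda>s. partial_x u1 x s) differentiable (at t) \<and>
       (\<lambda>s. partial_x u2 x s) differentiable (at t) \<and>
       partial_t (partial_x u1) x t + u1 x t
         + \<i> * complex_of_real ((cmod (u1 x t))\<^sup>2 + 1/2 * (cmod (u2 x t))\<^sup>2) * partial_x u1 x t
         + \<i> / 2 * u1 x t * cnj (u2 x t) * partial_x u2 x t = 0 \<and>
       partial_t (partial_x u2) x t + u2 x t
         + \<i> * complex_of_real ((cmod (u2 x t))\<^sup>2 + 1/2 * (cmod (u1 x t))\<^sup>2) * partial_x u2 x t
         + \<i> / 2 * u2 x t * cnj (u1 x t) * partial_x u1 x t = 0)"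

section \<open>Plane-wave background and the spatial cubic\<close>

definition omega1 :: "real \<Rightarrow> real \<Rightarrow> real" where
  "omega1 A k = 1 / k - A"

definition omega2 :: "real \<Rightarrow> real \<Rightarrow> real" where
  "omega2 B k = - 1 / k - B"

text \<open>The wave numbers of the two components are \<open>k\<close> and \<open>- k\<close>.\<close>

definition u10 :: "real \<Rightarrow> real \<Rightarrow> real \<Rightarrow> real \<Rightarrow> real \<Rightarrow> complex" where
  "u10 A k a1 x t = complex_of_real a1 * exp (\<i> * complex_of_real (k * x + omega1 A k * t))"

definition u20 :: "real \<Rightarrow> real \<Rightarrow> real \<Rightarrow> real \<Rightarrow> real \<Rightarrow> complex" where
  "u20 B k a2 x t = complex_of_real a2 * exp (\<i> * complex_of_real (- k * x + omega2 B k * t))"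

text \<open>\<open>S = A + B\<close> and \<open>R = A - B\<close> are written out.\<close>

definition spatial_cubic :: "real \<Rightarrow> real \<Rightarrow> real \<Rightarrow> complex \<Rightarrow> complex \<Rightarrow> complex" where
  "spatial_cubic A B k chi mu =
     mu * chi ^ 3 - 2 * chi ^ 2
     + complex_of_real (k\<^sup>2) * (complex_of_real (A + B) - mu) * chi
     + complex_of_real (k\<^sup>2 * (2 - k * (A - B)))"

definition nu :: "real \<Rightarrow> real \<Rightarrow> real \<Rightarrow> complex \<Rightarrow> complex" where
  "nu A B k chi = complex_of_real ((A + B) / 2) + complex_of_real (2 - k * (A - B)) / (2 * chi)"

definition E_fun :: "real \<Rightarrow> real \<Rightarrow> real \<Rightarrow> real \<Rightarrow> real \<Rightarrow> complex \<Rightarrow> complex" where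
  "E_fun A B k x t chi =
     exp (\<i> * (chi * complex_of_real x + nu A B k chi * complex_of_real t))"

definition h1 :: "real \<Rightarrow> complex \<Rightarrow> complex" where
  "h1 k chi = complex_of_real k / (complex_of_real k + chi)"

definition h2 :: "real \<Rightarrow> complex \<Rightarrow> complex" where
  "h2 k chi = complex_of_real k / (complex_of_real k - chi)"

definition y_vec ::
    "real \<Rightarrow> real \<Rightarrow> real \<Rightarrow> real \<Rightarrow> real \<Rightarrow> real \<Rightarrow> real \<Rightarrow> complex \<Rightarrow> real \<Rightarrow> complex^3" where
  "y_vec A B k a1 a2 x t chi lam =
     vector [complex_of_real lam * E_fun A B k x t chi,
             u10 A k a1 x t * h1 k chi * E_fun A B k x t chi,
             u20 B k a2 x t * h2 k chi * E_fun A B k x t chi]"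

section \<open>Derivatives at the triple root\<close>

text \<open>All functions of \<open>chi\<close> above are holomorphic away from \<open>0\<close>, \<open>k\<close> and \<open>- k\<close>; the
  derivatives with respect to \<open>chi\<close> are complex derivatives, which at a real point agree with the
  derivatives along the real axis.\<close>

definition E_der ::
    "real \<Rightarrow> real \<Rightarrow> real \<Rightarrow> complex \<Rightarrow> nat \<Rightarrow> real \<Rightarrow> real \<Rightarrow> complex" where
  "E_der A B k chi0 n x t = (deriv ^^ n) (E_fun A B k x t) chi0"

definition Y_vec ::
    "real \<Rightarrow> real \<Rightarrow> real \<Rightarrow> real \<Rightarrow> real \<Rightarrow> complex \<Rightarrow> real \<Rightarrow> nat \<Rightarrow> real \<Rightarrow> real \<Rightarrow> complex^3" where
  "Y_vec A B k a1 a2 chi0 lam n x t =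
     (\<chi> i. (deriv ^^ n) (\<lambda>chi. y_vec A B k a1 a2 x t chi lam $ i) chi0)"

definition J_mat :: "complex^3^3" where
  "J_mat = (\<chi> i j. if i = j then (if i = 1 then 1 else - 1) else 0)"

definition K_mat :: "complex^3^3" where
  "K_mat = mat 1"

definition braket :: "complex^3 \<Rightarrow> complex^3^3 \<Rightarrow> complex^3 \<Rightarrow> complex" where
  "braket f M g = (\<Sum>i\<in>UNIV. cnj (f $ i) * (M *v g) $ i)"

definition hermitian_dot :: "complex^3 \<Rightarrow> complex^3 \<Rightarrow> complex" where
  "hermitian_dot f g = (\<Sum>i\<in>UNIV. cnj (f $ i) * g $ i)"

text \<open>The Gram entries of \<open>J\<close> do not depend on \<open>(x, t)\<close> and are real when \<open>chi0\<close> is a triple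
  root; they are read off at the origin, without presupposing this.\<close>

definition gram ::
    "real \<Rightarrow> real \<Rightarrow> real \<Rightarrow> real \<Rightarrow> real \<Rightarrow> complex \<Rightarrow> real \<Rightarrow> nat \<Rightarrow> nat \<Rightarrow> real" where
  "gram A B k a1 a2 chi0 lam m n =
     Re (braket (Y_vec A B k a1 a2 chi0 lam m 0 0) J_mat (Y_vec A B k a1 a2 chi0 lam n 0 0))"

section \<open>The third-order rational dressing\<close>

definition D0 :: "real \<Rightarrow> complex \<Rightarrow> complex" where
  "D0 k chi0 = chi0 ^ 3 - complex_of_real (k\<^sup>2) * chi0"

definition D1 :: "real \<Rightarrow> complex \<Rightarrow> complex" where
  "D1 k chi0 = 3 * chi0\<^sup>2 - complex_of_real (k\<^sup>2)"

definition calM3 :: "real \<Rightarrow> complex \<Rightarrow> complex \<Rightarrow> complex \<Rightarrow> complex \<Rightarrow> complex" where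
  "calM3 k chi0 mu0 M1 M2 = - (3 * chi0 * M2 + D1 k chi0 * M1 + D0 k chi0) / mu0"

definition calM4 :: "real \<Rightarrow> complex \<Rightarrow> complex \<Rightarrow> complex \<Rightarrow> complex \<Rightarrow> complex" where
  "calM4 k chi0 mu0 M1 M2 = - (D1 k chi0 * M2 + D0 k chi0 * M1) / mu0"

definition calM5 :: "real \<Rightarrow> complex \<Rightarrow> complex \<Rightarrow> complex \<Rightarrow> complex" where
  "calM5 k chi0 mu0 M2 = - (D0 k chi0 * M2) / mu0"

definition yR_vec ::
    "real \<Rightarrow> real \<Rightarrow> real \<Rightarrow> real \<Rightarrow> real \<Rightarrow> complex \<Rightarrow> real \<Rightarrow> complex \<Rightarrow> complex
      \<Rightarrow> real \<Rightarrow> real \<Rightarrow> complex^3" where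
  "yR_vec A B k a1 a2 chi0 lam M1 M2 x t =
     Y_vec A B k a1 a2 chi0 lam 0 x t
     + M1 *s Y_vec A B k a1 a2 chi0 lam 1 x t
     + (M2 / 2) *s Y_vec A B k a1 a2 chi0 lam 2 x t"

definition ymu_vec ::
    "real \<Rightarrow> real \<Rightarrow> real \<Rightarrow> real \<Rightarrow> real \<Rightarrow> complex \<Rightarrow> complex \<Rightarrow> real \<Rightarrow> complex \<Rightarrow> complex
      \<Rightarrow> real \<Rightarrow> real \<Rightarrow> complex^3" where
  "ymu_vec A B k a1 a2 chi0 mu0 lam M1 M2 x t =
     complex_of_real (1 / (2 * lam)) *s
       vector [E_der A B k chi0 0 x t + M1 * E_der A B k chi0 1 x t
                 + M2 / 2 * E_der A B k chi0 2 x t, 0, 0]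
     + (calM3 k chi0 mu0 M1 M2 / 6) *s Y_vec A B k a1 a2 chi0 lam 3 x t
     + (calM4 k chi0 mu0 M1 M2 / 24) *s Y_vec A B k a1 a2 chi0 lam 4 x t
     + (calM5 k chi0 mu0 M2 / 120) *s Y_vec A B k a1 a2 chi0 lam 5 x t"

definition m_zeta :: "complex \<Rightarrow> real \<Rightarrow> complex^3 \<Rightarrow> complex^3 \<Rightarrow> complex" where
  "m_zeta zeta lam yR ymu =
     complex_of_real (2 * lam) / (cnj zeta - zeta)
       * (cnj zeta * braket ymu J_mat yR + zeta * braket yR J_mat ymu)
     - braket yR K_mat yR / complex_of_real (2 * lam)"

end

theory Submission
  imports Defs "HOL-Complex_Analysis.Cauchy_Integral_Formula"
begin

text \<open>The system is the compatibility condition of the Lax pair, with \<open>v = u\<^sub>x\<close>,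
  \[ \psi_x = \frac{2i}{\lambda^2}\psi + \frac1\lambda v^\dagger\phi, \quad
     \phi_x = \frac1\lambda v\psi, \quad
     \psi_t = \frac i2(|u|^2 + \lambda^2)\psi - \frac{i\lambda}2 u^\dagger\phi, \quad
     \phi_t = \frac i2 u(\lambda\psi - u^\dagger\phi). \]
  On the plane wave, \<open>y(\<chi>, \<lambda>)\<close> satisfies it up to a multiple of \<open>F(\<chi>; \<lambda>\<^sup>2)\<close>. At a triple root the
  combinations of \<open>Y\<^sub>0, Y\<^sub>1, Y\<^sub>2\<close> are exact solutions, and the coefficients of \<open>Y\<^sub>3, Y\<^sub>4, Y\<^sub>5\<close>
  are such that \<open>y\<^sub>\<mu>\<close> solves the Lax pair differentiated in \<open>\<mu> = \<lambda>\<^sup>2\<close>.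
  Then \<open>\<Omega> = \<langle>y\<^sub>\<mu>|J|y\<^sub>R\<rangle>\<close> has purely imaginary derivatives, so \<open>m\<close> satisfies, whatever \<open>\<zeta>\<close>,
  \[ m_x = \frac{4i}{\lambda^3}|\psi|^2 - \frac2{\lambda^2}\psi\,\phi^\dagger v, \qquad
     m_t = -i\psi^*(\lambda\psi - u^\dagger\phi), \qquad
     m + m^* = -\frac2\lambda|\psi|^2, \]
  the last by nullity of \<open>y\<^sub>R\<close>. From these equations alone, \<open>u + 2\<psi>\<^sup>*\<phi>/m\<close> solves the system.\<close>

section \<open>Elementary fields are smooth\<close>

text \<open>\<open>y_R\<close> and the jet part of \<open>y_mu\<close> are treated as finite-order
  functionals L (orders 0 to 2) and N (orders 3 to 5) at the triple root, applied to one holomorphic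
  family in the spectral parameter. Each Lax equation then becomes an identity between multipliers,
  and no high derivative has to be computed. The failure of the family to solve the Lax pair is F
  times a cofactor g, and L kills it because F has a triple zero. Differentiation in mu leads to the
  requirement N(F g) + L(F_mu g) = 0 with F_mu = chi^3 - k^2 chi. Matching the Taylor coefficients
  of F_mu at the root determines N: this is the origin of \<open>calM3\<close>,
  \<open>calM4\<close>, \<open>calM5\<close>. The strict inequality is the delicate point. Nullity
  only gives Re m = -|psi|^2 / lambda, so psi must be shown never to vanish, for all admissible
  \<open>M1\<close>, \<open>M2\<close>. Smoothness concerns all iterated partials; it is obtained by
  placing the fields in a class of expressions that is closed under differentiation.\<close>

inductive elementary_field :: "(real \<Rightarrow> real \<Rightarrow> complex) \<Rightarrow> bool" where
  elementary_const: "elementary_field (\<lambda>x t. c)"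
| elementary_x: "elementary_field (\<lambda>x t. of_real x)"
| elementary_t: "elementary_field (\<lambda>x t. of_real t)"
| elementary_add: "elementary_field f \<Longrightarrow> elementary_field g
    \<Longrightarrow> elementary_field (\<lambda>x t. f x t + g x t)"
| elementary_mult: "elementary_field f \<Longrightarrow> elementary_field g
    \<Longrightarrow> elementary_field (\<lambda>x t. f x t * g x t)"
| elementary_cnj: "elementary_field f \<Longrightarrow> elementary_field (\<lambda>x t. cnj (f x t))"
| elementary_exp: "elementary_field f \<Longrightarrow> elementary_field (\<lambda>x t. exp (f x t))"
| elementary_inverse: "elementary_field f \<Longrightarrow> (\<And>x t. f x t \<noteq> 0)
    \<Longrightarrow> elementary_field (\<lambda>x t. inverse (f x t))"

lemma elementary_uminus: "elementary_field f \<Longrightarrow> elementary_field (\<lambda>x t. - f x t)"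
  using elementary_mult[OF elementary_const[of "-1"]] by fastforce

lemma elementary_diff: "elementary_field f \<Longrightarrow> elementary_field g
    \<Longrightarrow> elementary_field (\<lambda>x t. f x t - g x t)"
  using elementary_add[OF _ elementary_uminus, of f g] by simp

lemma elementary_divide: "elementary_field f \<Longrightarrow> elementary_field g \<Longrightarrow> (\<And>x t. g x t \<noteq> 0)
    \<Longrightarrow> elementary_field (\<lambda>x t. f x t / g x t)"
  using elementary_mult[OF _ elementary_inverse, of f g] by (simp add: field_simps)

lemma elementary_sum:
  "(\<And>i. i \<in> I \<Longrightarrow> elementary_field (f i)) \<Longrightarrow> elementary_field (\<lambda>x t. \<Sum>i\<in>I. f i x t)"
  by (induction I rule: infinite_finite_induct) (auto intro: elementary_field.intros)

lemmas elementary_intros = elementary_field.intros elementary_uminus elementary_diff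
  elementary_divide elementary_sum

lemma has_vector_derivative_exp_complex:
  assumes "(f has_vector_derivative f') (at (s::real))"
  shows "((\<lambda>s. exp (f s :: complex)) has_vector_derivative f' * exp (f s)) (at s)"
  using field_vector_diff_chain_at[OF assms DERIV_exp] by (simp add: o_def)

lemma has_vector_derivative_inverse_complex:
  assumes "(f has_vector_derivative f') (at (s::real))" and "f s \<noteq> (0::complex)"
  shows "((\<lambda>s. inverse (f s)) has_vector_derivative - f' * inverse (f s) * inverse (f s)) (at s)"
  using field_vector_diff_chain_at[OF assms(1) DERIV_inverse[OF assms(2)]]
  by (simp add: o_def power2_eq_square mult.assoc)

lemma has_vector_derivative_divide_complex:
  assumes "(f has_vector_derivative f') (at (s::real))" and "(g has_vector_derivative g') (at s)"
    and "g s \<noteq> (0::complex)"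
  shows "((\<lambda>s. f s / g s) has_vector_derivative f' / g s - f s * g' / (g s)\<^sup>2) (at s)"
  using has_vector_derivative_mult[OF assms(1) has_vector_derivative_inverse_complex[OF assms(2,3)]]
  by (simp add: field_simps power2_eq_square)

text \<open>Closure under both partials drives the later induction over
  \<open>iterated_partials\<close>. Genuine derivative statements are produced as well, because
  \<open>partial_x\<close> and \<open>partial_t\<close> are total and assert no
  differentiability.\<close>

lemma elementary_partials:
  assumes "elementary_field f"
  obtains fx ft where "elementary_field fx" "elementary_field ft"
    "\<And>x t. ((\<lambda>s. f s t) has_vector_derivative fx x t) (at x)"
    "\<And>x t. ((\<lambda>s. f x s) has_vector_derivative ft x t) (at t)"
  using assms
proof (induction arbitrary: thesis)
  case (elementary_const c)
  show ?case
    by (rule elementary_const[of "\<lambda>x t. 0" "\<lambda>x t. 0"]) (auto intro: elementary_field.intros)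
next
  case elementary_x
  show ?case
    by (rule elementary_x[of "\<lambda>x t. 1" "\<lambda>x t. 0"])
      (auto intro!: elementary_field.intros derivative_eq_intros)
next
  case elementary_t
  show ?case
    by (rule elementary_t[of "\<lambda>x t. 0" "\<lambda>x t. 1"])
      (auto intro!: elementary_field.intros derivative_eq_intros)
next
  case (elementary_add f g)
  obtain fx ft where f: "elementary_field fx" "elementary_field ft"
    "\<And>x t. ((\<lambda>s. f s t) has_vector_derivative fx x t) (at x)"
    "\<And>x t. ((\<lambda>s. f x s) has_vector_derivative ft x t) (at t)"
    using elementary_add.IH(1) by blast
  obtain gx gt where g: "elementary_field gx" "elementary_field gt"
    "\<And>x t. ((\<lambda>s. g s t) has_vector_derivative gx x t) (at x)"
    "\<And>x t. ((\<lambda>s. g x s) has_vector_derivative gt x t) (at t)"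
    using elementary_add.IH(2) by blast
  show ?case
    by (rule elementary_add.prems[of "\<lambda>x t. fx x t + gx x t" "\<lambda>x t. ft x t + gt x t"])
      (intro elementary_field.intros f g has_vector_derivative_add)+
next
  case (elementary_mult f g)
  obtain fx ft where f: "elementary_field fx" "elementary_field ft"
    "\<And>x t. ((\<lambda>s. f s t) has_vector_derivative fx x t) (at x)"
    "\<And>x t. ((\<lambda>s. f x s) has_vector_derivative ft x t) (at t)"
    using elementary_mult.IH(1) by blast
  obtain gx gt where g: "elementary_field gx" "elementary_field gt"
    "\<And>x t. ((\<lambda>s. g s t) has_vector_derivative gx x t) (at x)"
    "\<And>x t. ((\<lambda>s. g x s) has_vector_derivative gt x t) (at t)"
    using elementary_mult.IH(2) by blast
  show ?case
    by (rule elementary_mult.prems[of "\<lambda>x t. f x t * gx x t + fx x t * g x t"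
          "\<lambda>x t. f x t * gt x t + ft x t * g x t"])
      (intro elementary_field.intros f g elementary_mult.hyps has_vector_derivative_mult)+
next
  case (elementary_cnj f)
  obtain fx ft where f: "elementary_field fx" "elementary_field ft"
    "\<And>x t. ((\<lambda>s. f s t) has_vector_derivative fx x t) (at x)"
    "\<And>x t. ((\<lambda>s. f x s) has_vector_derivative ft x t) (at t)"
    using elementary_cnj.IH by blast
  show ?case
    by (rule elementary_cnj.prems[of "\<lambda>x t. cnj (fx x t)" "\<lambda>x t. cnj (ft x t)"])
      (intro elementary_field.intros f has_vector_derivative_cnj)+
next
  case (elementary_exp f)
  obtain fx ft where f: "elementary_field fx" "elementary_field ft"
    "\<And>x t. ((\<lambda>s. f s t) has_vector_derivative fx x t) (at x)"
    "\<And>x t. ((\<lambda>s. f x s) has_vector_derivative ft x t) (at t)"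
    using elementary_exp.IH by blast
  show ?case
    by (rule elementary_exp.prems[of "\<lambda>x t. fx x t * exp (f x t)" "\<lambda>x t. ft x t * exp (f x t)"])
      (intro elementary_field.intros f elementary_exp.hyps has_vector_derivative_exp_complex)+
next
  case (elementary_inverse f)
  obtain fx ft where f: "elementary_field fx" "elementary_field ft"
    "\<And>x t. ((\<lambda>s. f s t) has_vector_derivative fx x t) (at x)"
    "\<And>x t. ((\<lambda>s. f x s) has_vector_derivative ft x t) (at t)"
    using elementary_inverse.IH by blast
  show ?case
    by (rule elementary_inverse.prems[of "\<lambda>x t. - fx x t * inverse (f x t) * inverse (f x t)"
          "\<lambda>x t. - ft x t * inverse (f x t) * inverse (f x t)"])
      (intro elementary_field.intros elementary_uminus f elementary_inverse.hyps
        has_vector_derivative_inverse_complex)+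
qed

lemma elementary_continuous:
  "elementary_field f \<Longrightarrow> continuous_on UNIV (\<lambda>(x, t). f x t)"
  by (induction rule: elementary_field.induct)
    (auto simp: case_prod_unfold intro!: continuous_intros)

lemma elementary_partial:
  assumes "elementary_field f"
  shows "elementary_field (partial_x f)" "elementary_field (partial_t f)"
    "(\<lambda>s. f s t) differentiable (at x)" "(\<lambda>s. f x s) differentiable (at t)"
proof -
  obtain fx ft where f: "elementary_field fx" "elementary_field ft"
    "\<And>x t. ((\<lambda>s. f s t) has_vector_derivative fx x t) (at x)"
    "\<And>x t. ((\<lambda>s. f x s) has_vector_derivative ft x t) (at t)"
    using elementary_partials[OF assms] by blast
  have "partial_x f = fx" "partial_t f = ft"
    using f(3,4) by (simp_all add: partial_x_def partial_t_def vector_derivative_at fun_eq_iff)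
  with f show "elementary_field (partial_x f)" "elementary_field (partial_t f)"
    by simp_all
  show "(\<lambda>s. f s t) differentiable (at x)" "(\<lambda>s. f x s) differentiable (at t)"
    using f(3,4) differentiableI_vector by blast+
qed

lemma elementary_smooth:
  assumes "elementary_field f"
  shows "smooth_on_plane f"
proof -
  have "elementary_field v" if "v \<in> iterated_partials f" for v
    using that by induction (auto intro: assms elementary_partial)
  then show ?thesis
    unfolding smooth_on_plane_def using elementary_continuous elementary_partial(3,4) by blast
qed

section \<open>Jets of exponentials\<close>

text \<open>\<open>a\<close> and \<open>b\<close> are the phases in x and t. The multiplier
  \<open>g\<close> stays free below because, up to background factors, the components of the
  eigenfunction and their x- and t-derivatives differ only in it: 1, \<open>h1 k\<close>,
  \<open>h2 k\<close> and products with the phases.\<close>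

locale exponential_jets =
  fixes a b :: "complex \<Rightarrow> complex" and S :: "complex set" and z :: complex
  assumes open_S: "open S" and z_in_S: "z \<in> S"
    and holo_a: "a holomorphic_on S" and holo_b: "b holomorphic_on S"
begin

definition wave :: "(complex \<Rightarrow> complex) \<Rightarrow> real \<Rightarrow> real \<Rightarrow> complex \<Rightarrow> complex" where
  "wave g x t w = exp (a w * of_real x + b w * of_real t) * g w"

definition jet :: "nat \<Rightarrow> (complex \<Rightarrow> complex) \<Rightarrow> real \<Rightarrow> real \<Rightarrow> complex" where
  "jet n g x t = (deriv ^^ n) (wave g x t) z"

lemma holo_wave: "g holomorphic_on S \<Longrightarrow> wave g x t holomorphic_on S"
  unfolding wave_def by (intro holomorphic_intros holo_a holo_b)

lemma jet_add:
  assumes "f holomorphic_on S" "g holomorphic_on S"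
  shows "jet n (\<lambda>w. f w + g w) x t = jet n f x t + jet n g x t"
proof -
  have "wave (\<lambda>w. f w + g w) x t = (\<lambda>w. wave f x t w + wave g x t w)"
    by (auto simp: wave_def algebra_simps)
  then show ?thesis
    by (simp add: jet_def higher_deriv_add[OF holo_wave holo_wave open_S z_in_S] assms)
qed

lemma jet_cmult:
  assumes "g holomorphic_on S"
  shows "jet n (\<lambda>w. c * g w) x t = c * jet n g x t"
proof -
  have "wave (\<lambda>w. c * g w) x t = (\<lambda>w. c * wave g x t w)"
    by (auto simp: wave_def algebra_simps)
  then show ?thesis
    by (simp add: jet_def higher_deriv_cmult[OF holo_wave z_in_S open_S] assms)
qed

lemma jet_cong:
  assumes "f holomorphic_on S" "\<And>w. w \<in> S \<Longrightarrow> f w = g w"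
  shows "jet n f x t = jet n g x t"
proof -
  have "g holomorphic_on S"
    using assms holomorphic_transform by blast
  with assms show ?thesis
    unfolding jet_def
    by (intro higher_deriv_transform_within_open[OF _ _ open_S z_in_S] holo_wave)
      (auto simp: wave_def)
qed

lemma jet_0: "jet 0 g x t = exp (a z * of_real x + b z * of_real t) * g z"
  by (simp add: jet_def wave_def)

lemma jet_Suc:
  assumes "g holomorphic_on S"
  shows "jet (Suc n) g x t = of_real x * jet n (\<lambda>w. deriv a w * g w) x t
           + of_real t * jet n (\<lambda>w. deriv b w * g w) x t + jet n (deriv g) x t"
proof -
  let ?a = "\<lambda>w. deriv a w * g w" and ?b = "\<lambda>w. deriv b w * g w"
  have holo: "?a holomorphic_on S" "?b holomorphic_on S" "deriv g holomorphic_on S"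
    using assms holo_a holo_b open_S by (auto intro!: holomorphic_intros holomorphic_deriv)
  have deriv_wave: "deriv (wave g x t) w = of_real x * wave ?a x t w
      + of_real t * wave ?b x t w + wave (deriv g) x t w" if "w \<in> S" for w
  proof -
    have "(a has_field_derivative deriv a w) (at w)" "(b has_field_derivative deriv b w) (at w)"
      "(g has_field_derivative deriv g w) (at w)"
      using that holomorphic_derivI open_S holo_a holo_b assms by blast+
    then have "(wave g x t has_field_derivative (deriv a w * of_real x + deriv b w * of_real t)
        * exp (a w * of_real x + b w * of_real t) * g w
        + deriv g w * exp (a w * of_real x + b w * of_real t)) (at w)"
      unfolding wave_def by (auto intro!: derivative_eq_intros)
    then show ?thesis
      by (simp add: DERIV_imp_deriv wave_def algebra_simps)
  qed
  have "jet (Suc n) g x t = (deriv ^^ n) (deriv (wave g x t)) z"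
    by (simp add: jet_def funpow_swap1)
  also have "\<dots> = (deriv ^^ n) (\<lambda>w. (of_real x * wave ?a x t w
      + of_real t * wave ?b x t w) + wave (deriv g) x t w) z"
    using deriv_wave holo open_S assms
    by (intro higher_deriv_transform_within_open[OF _ _ open_S z_in_S])
      (auto intro!: holomorphic_intros holomorphic_deriv holo_wave)
  also have "\<dots> = of_real x * jet n ?a x t + of_real t * jet n ?b x t + jet n (deriv g) x t"
    by (simp add: jet_def holo holo_wave holomorphic_on_add holomorphic_on_mult
        higher_deriv_add[OF _ _ open_S z_in_S] higher_deriv_cmult[OF _ z_in_S open_S])
  finally show ?thesis .
qed

lemma elementary_jet:
  "g holomorphic_on S \<Longrightarrow> elementary_field (jet n g)"
proof (induction n arbitrary: g)
  case 0
  have "jet 0 g = (\<lambda>x t. exp (a z * of_real x + b z * of_real t) * g z)"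
    by (simp add: jet_0 fun_eq_iff)
  then show ?case
    by (auto intro!: elementary_field.intros)
next
  case (Suc n)
  have holo: "(\<lambda>w. deriv a w * g w) holomorphic_on S" "(\<lambda>w. deriv b w * g w) holomorphic_on S"
    "deriv g holomorphic_on S"
    using Suc.prems holo_a holo_b open_S by (auto intro!: holomorphic_intros holomorphic_deriv)
  have "jet (Suc n) g = (\<lambda>x t. of_real x * jet n (\<lambda>w. deriv a w * g w) x t
           + of_real t * jet n (\<lambda>w. deriv b w * g w) x t + jet n (deriv g) x t)"
    using jet_Suc[OF Suc.prems] by blast
  then show ?case
    using Suc.IH[OF holo(1)] Suc.IH[OF holo(2)] Suc.IH[OF holo(3)]
    by (auto intro!: elementary_field.intros)
qed

text \<open>Equivalently, \<open>\<partial>\<^sub>x\<close> commutes with the derivatives in the spectral parameter. Generalising over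
  \<open>g\<close> lets the induction absorb the factors produced by \<open>jet_Suc\<close>.\<close>

lemma jet_deriv_x:
  "g holomorphic_on S
    \<Longrightarrow> ((\<lambda>s. jet n g s t) has_vector_derivative jet n (\<lambda>w. a w * g w) x t) (at x)"
proof (induction n arbitrary: g)
  case 0
  show ?case
    unfolding jet_0
    by (auto intro!: derivative_eq_intros has_vector_derivative_exp_complex)
next
  case (Suc n)
  let ?a = "\<lambda>w. deriv a w * g w" and ?b = "\<lambda>w. deriv b w * g w"
  have holo: "?a holomorphic_on S" "?b holomorphic_on S" "deriv g holomorphic_on S"
    "(\<lambda>w. a w * g w) holomorphic_on S" "deriv a holomorphic_on S" "deriv b holomorphic_on S"
    using Suc.prems holo_a holo_b open_S by (auto intro!: holomorphic_intros holomorphic_deriv)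
  have "jet n (deriv (\<lambda>w. a w * g w)) x t
      = jet n (\<lambda>w. a w * deriv g w + ?a w) x t"
  proof (rule jet_cong)
    show "deriv (\<lambda>w. a w * g w) holomorphic_on S"
      using holo(4) open_S by (rule holomorphic_deriv)
    show "deriv (\<lambda>w. a w * g w) w = a w * deriv g w + ?a w" if "w \<in> S" for w
      using that Suc.prems holo_a open_S
      by (intro deriv_mult) (auto simp: holomorphic_on_imp_differentiable_at)
  qed
  also have "\<dots> = jet n (\<lambda>w. a w * deriv g w) x t + jet n ?a x t"
    using holo holo_a by (intro jet_add) (auto intro!: holomorphic_intros)
  \<comment> \<open>The extra jet of \<open>?a\<close> is the derivative of the explicit factor
    \<open>of_real x\<close> that \<open>jet_Suc\<close> brings down.\<close>
  finally have "jet (Suc n) (\<lambda>w. a w * g w) x t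
      = jet n ?a x t + of_real x * jet n (\<lambda>w. a w * ?a w) x t
        + of_real t * jet n (\<lambda>w. a w * ?b w) x t + jet n (\<lambda>w. a w * deriv g w) x t"
    by (simp add: jet_Suc[OF holo(4)] algebra_simps)
  then show ?case
    unfolding jet_Suc[OF Suc.prems]
    by (auto intro!: derivative_eq_intros Suc.IH holo)
qed

text \<open>The locale is symmetric under exchanging (a, x) with (b, t), so the induction for x is
  reused.\<close>

lemma jet_deriv_t:
  "g holomorphic_on S
    \<Longrightarrow> ((\<lambda>s. jet n g x s) has_vector_derivative jet n (\<lambda>w. b w * g w) x t) (at t)"
proof -
  interpret swapped: exponential_jets b a S z
    by unfold_locales (auto intro: open_S z_in_S holo_a holo_b)
  have "swapped.jet n f t x = jet n f x t" for f :: "complex \<Rightarrow> complex" and x t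
    by (simp add: swapped.jet_def jet_def swapped.wave_def[abs_def] wave_def[abs_def] add.commute)
  then show "g holomorphic_on S
    \<Longrightarrow> ((\<lambda>s. jet n g x s) has_vector_derivative jet n (\<lambda>w. b w * g w) x t) (at t)"
    using swapped.jet_deriv_x[of g n x t] by simp
qed

text \<open>\<open>w - z\<close> has a simple zero at \<open>z\<close>, so a single Leibniz term
  survives. For n = 0 the truncated index \<open>n - 1\<close> is harmless because of the factor
  \<open>of_nat n\<close>.\<close>

lemma jet_lower:
  assumes "g holomorphic_on S"
  shows "jet n (\<lambda>w. (w - z) * g w) x t = of_nat n * jet (n - 1) g x t"
proof -
  have eq: "wave (\<lambda>w. (w - z) * g w) x t = (\<lambda>w. (w - z) * wave g x t w)"
    by (auto simp: wave_def algebra_simps)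
  have d: "(deriv ^^ i) (\<lambda>w. w - z) z = (if i = 1 then 1 else 0)" for i
  proof -
    have "(deriv ^^ i) (\<lambda>w. w - z) z = (deriv ^^ i) (\<lambda>w. w) z - (deriv ^^ i) (\<lambda>w. z) z"
      by (intro higher_deriv_diff[OF _ _ open_S z_in_S] holomorphic_intros)
    then show ?thesis by auto
  qed
  have "jet n (\<lambda>w. (w - z) * g w) x t
      = (\<Sum>i = 0..n. of_nat (n choose i) * (deriv ^^ i) (\<lambda>w. w - z) z
          * (deriv ^^ (n - i)) (wave g x t) z)"
    unfolding jet_def eq
    by (intro higher_deriv_mult[OF _ _ open_S z_in_S] holomorphic_intros holo_wave assms)
  also have "\<dots> = (\<Sum>i = 0..n. if i = 1 then of_nat n * jet (n - 1) g x t else 0)"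
    by (intro sum.cong) (auto simp: d jet_def)
  also have "\<dots> = of_nat n * jet (n - 1) g x t"
    by (cases n) auto
  finally show ?thesis .
qed

text \<open>A functional of order below \<open>d\<close> supported at \<open>z\<close>. Multiplying
  its argument by \<open>w - z\<close> acts as a weighted shift on the coefficients
  (\<open>jet_comb_lower\<close>).\<close>

definition jet_comb :: "nat \<Rightarrow> (nat \<Rightarrow> complex) \<Rightarrow> (complex \<Rightarrow> complex) \<Rightarrow> real \<Rightarrow> real \<Rightarrow> complex" where
  "jet_comb d c g x t = (\<Sum>n<d. c n * jet n g x t)"

lemma jet_comb_add:
  "f holomorphic_on S \<Longrightarrow> g holomorphic_on S
    \<Longrightarrow> jet_comb d c (\<lambda>w. f w + g w) x t = jet_comb d c f x t + jet_comb d c g x t"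
  by (simp add: jet_comb_def jet_add ring_distribs sum.distrib)

lemma jet_comb_cmult:
  "g holomorphic_on S \<Longrightarrow> jet_comb d c (\<lambda>w. r * g w) x t = r * jet_comb d c g x t"
  by (simp add: jet_comb_def jet_cmult sum_distrib_left mult.left_commute)

lemma jet_comb_cong:
  "f holomorphic_on S \<Longrightarrow> (\<And>w. w \<in> S \<Longrightarrow> f w = g w) \<Longrightarrow> jet_comb d c f x t = jet_comb d c g x t"
  unfolding jet_comb_def using jet_cong by (intro sum.cong) auto

lemma elementary_jet_comb: "g holomorphic_on S \<Longrightarrow> elementary_field (jet_comb d c g)"
  unfolding jet_comb_def
  by (intro elementary_sum elementary_mult elementary_const elementary_jet)

lemma jet_comb_deriv_x:
  "g holomorphic_on S
    \<Longrightarrow> ((\<lambda>s. jet_comb d c g s t) has_vector_derivative jet_comb d c (\<lambda>w. a w * g w) x t) (at x)"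
  unfolding jet_comb_def
  by (intro has_vector_derivative_sum has_vector_derivative_mult_right jet_deriv_x)

lemma jet_comb_deriv_t:
  "g holomorphic_on S
    \<Longrightarrow> ((\<lambda>s. jet_comb d c g x s) has_vector_derivative jet_comb d c (\<lambda>w. b w * g w) x t) (at t)"
  unfolding jet_comb_def
  by (intro has_vector_derivative_sum has_vector_derivative_mult_right jet_deriv_t)

lemma jet_comb_lower:
  assumes "g holomorphic_on S"
  shows "jet_comb (Suc d) c (\<lambda>w. (w - z) * g w) x t
    = jet_comb d (\<lambda>n. of_nat (Suc n) * c (Suc n)) g x t"
  by (simp add: jet_comb_def sum.lessThan_Suc_shift jet_lower[OF assms] mult.left_commute mult.assoc
      del: of_nat_Suc sum.lessThan_Suc)

end

section \<open>The dressing transformation\<close>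

text \<open>Conjugates enter as independent variables (\<open>pc\<close>, \<open>mc\<close>), which
  makes this and the next identities rational. With tau = s/l - 2i pc/l^2 the prescribed
  x-derivative of m is -(2p/l) tau. Hence the left side factors as (1 + 2 p pc/(l m)) (v + 2 f
  tau/m), and \<open>mc\<close> turns the first factor into -mc/m.\<close>

lemma dressed_x_identity:
  fixes v p pc f s m mc l :: complex
  assumes "m \<noteq> 0" and mc: "mc = - m - 2 * p * pc / l"
  shows "v + (2 * ((s / l - 2 * \<i> / l\<^sup>2 * pc) * f + pc * (v * p / l)) / m
        - 2 * pc * f * (4 * \<i> * p * pc / l ^ 3 - 2 / l\<^sup>2 * p * s) / m\<^sup>2)
      = - (mc * (v + 2 * f * (s / l - 2 * \<i> / l\<^sup>2 * pc) / m)) / m"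
proof -
  define li mi where "li = inverse l" and "mi = inverse m"
  have mc': "mc * mi = - 1 - 2 * p * pc * li * mi"
    using assms(1) unfolding mc li_def mi_def by (simp add: field_simps)
  have "- (mc * (v + 2 * f * (s * li - 2 * \<i> * li\<^sup>2 * pc) * mi)) * mi
      = (1 + 2 * p * pc * li * mi) * (v + 2 * f * (s * li - 2 * \<i> * li\<^sup>2 * pc) * mi)"
    using mc' by algebra
  then show ?thesis
    unfolding divide_inverse power_inverse[symmetric] li_def[symmetric] mi_def[symmetric]
    by (simp add: algebra_simps power2_eq_square power3_eq_cube)
qed

text \<open>The N-terms of v and of pc combine to a multiple of tau. The products
  \<open>cc * d\<close> cancel, and so do the two single \<open>cc\<close>, which leaves only terms
  with the factor \<open>pc\<close>.\<close>

lemma tau_t_identity: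
  fixes u1 u2 v1 v2 u1c u2c p pc f1c f2c N l :: complex
  assumes "l \<noteq> 0" and cc: "cc = u1 * f1c + u2 * f2c" and d: "d = u1c * v1 + u2c * v2"
  shows "((- \<i> / 2 * (l * pc - cc) * u1c) * v1 + f1c * (- u1 - \<i> / 2 * N * v1 - \<i> / 2 * d * u1)
      + ((- \<i> / 2 * (l * pc - cc) * u2c) * v2 + f2c * (- u2 - \<i> / 2 * N * v2 - \<i> / 2 * d * u2))) / l
      - 2 * \<i> / l\<^sup>2 * (- \<i> / 2 * (N * pc + l * (l * pc - cc)))
    = - \<i> / 2 * N * ((f1c * v1 + f2c * v2) / l - 2 * \<i> / l\<^sup>2 * pc) - pc * (1 + \<i> / 2 * d)"
    (is "?lhs = ?rhs")
proof -
  have "?lhs = (- \<i> / 2 * (l * pc - cc) * d - cc - \<i> / 2 * N * (f1c * v1 + f2c * v2) - \<i> / 2 * d * cc) / l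
      - N * pc / l\<^sup>2 - (l * pc - cc) / l"
    using assms(1) unfolding cc d
    by (simp add: field_simps power2_eq_square)
  also have "\<dots> = ?rhs"
    using assms(1) by (simp add: field_simps power2_eq_square)
  finally show ?thesis .
qed

text \<open>For W = v + 2 f tau/m: apart from the N-terms, u and 2 pc f/m appear with the same
  coefficient, so that they assemble into the dressed u.\<close>

lemma W_t_identity:
  fixes u v pc f m N d tau e :: complex
  shows "(- u - \<i> / 2 * N * v - \<i> / 2 * d * u)
      + (2 * ((\<i> / 2 * e * u) * tau + f * (- \<i> / 2 * N * tau - pc * (1 + \<i> / 2 * d))) / m
          - 2 * f * tau * (- \<i> * pc * e) / m\<^sup>2)
    = - \<i> / 2 * N * (v + 2 * f * tau / m)
      - (1 + \<i> / 2 * d - \<i> * tau * e / m) * (u + 2 * pc / m * f)"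
proof -
  define mi where "mi = inverse m"
  show ?thesis
    unfolding divide_inverse[of _ m] divide_inverse[of _ "m\<^sup>2"] power_inverse[symmetric] mi_def[symmetric]
    by (simp add: algebra_simps power2_eq_square)
qed

text \<open>The term quadratic in the dressing carries f1 f1c + f2 f2c, which nullity replaces by p
  pc. The relation \<open>ml\<close> in the form l (1/m + 1/mc) = -2 p pc/(m mc) then splits it into
  the two terms that complete the linear ones.\<close>

lemma N_dressed_identity:
  fixes u1 u2 u1c u2c p pc f1 f2 f1c f2c m mc l :: complex
  assumes m: "m \<noteq> 0" "mc \<noteq> 0" and ml: "l * (m + mc) = - 2 * p * pc"
    and null: "p * pc = f1 * f1c + f2 * f2c"
  shows "- \<i> / 2 * ((u1 + 2 * pc / m * f1) * (u1c + 2 * p / mc * f1c)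
        + (u2 + 2 * pc / m * f2) * (u2c + 2 * p / mc * f2c))
    = - \<i> / 2 * (u1 * u1c + u2 * u2c) + \<i> * p * (l * pc - (u1 * f1c + u2 * f2c)) / mc
      + \<i> * pc * (l * p - (u1c * f1 + u2c * f2)) / m"
proof -
  define mi mci where "mi = inverse m" and "mci = inverse mc"
  have "l * (mi + mci) = l * (m + mc) * mi * mci"
    using m by (simp add: mi_def mci_def field_simps)
  then have eq: "l * (mi + mci) = - 2 * p * pc * mi * mci"
    unfolding ml .
  have "- \<i> / 2 * ((u1 + 2 * pc * mi * f1) * (u1c + 2 * p * mci * f1c)
        + (u2 + 2 * pc * mi * f2) * (u2c + 2 * p * mci * f2c))
    = - \<i> / 2 * (u1 * u1c + u2 * u2c) - \<i> * p * mci * (u1 * f1c + u2 * f2c)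
      - \<i> * pc * mi * (u1c * f1 + u2c * f2) + (- 2 * \<i> * p * pc * mi * mci * (f1 * f1c + f2 * f2c))"
    by (simp add: algebra_simps)
  also have "- 2 * \<i> * p * pc * mi * mci * (f1 * f1c + f2 * f2c)
      = \<i> * p * pc * l * (mi + mci)"
    using eq null by algebra
  finally have "- \<i> / 2 * ((u1 + 2 * pc * mi * f1) * (u1c + 2 * p * mci * f1c)
        + (u2 + 2 * pc * mi * f2) * (u2c + 2 * p * mci * f2c))
    = - \<i> / 2 * (u1 * u1c + u2 * u2c) + \<i> * p * (l * pc - (u1 * f1c + u2 * f2c)) * mci
      + \<i> * pc * (l * p - (u1c * f1 + u2c * f2)) * mi"
    by (simp add: algebra_simps)
  then show ?thesis
    by (simp only: divide_inverse[of _ m] divide_inverse[of _ mc] mi_def mci_def)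
qed

text \<open>The part of the product that contains m + mc contributes 1 + mc/m. Its 1 cancels the
  leading -1, so that the whole expression acquires the factor mc/m.\<close>

lemma d_dressed_identity:
  fixes v1 v2 u1c u2c p pc f1 f2 f1c f2c m mc l tau :: complex
  assumes l: "l \<noteq> 0" and m: "m \<noteq> 0" "mc \<noteq> 0" and ml: "l * (m + mc) = - 2 * p * pc"
    and null: "p * pc = f1 * f1c + f2 * f2c"
    and tau: "tau = (f1c * v1 + f2c * v2) / l - 2 * \<i> / l\<^sup>2 * pc"
  shows "- 1 - \<i> / 2 * ((u1c + 2 * p / mc * f1c) * (- (mc * (v1 + 2 * f1 * tau / m)) / m)
        + (u2c + 2 * p / mc * f2c) * (- (mc * (v2 + 2 * f2 * tau / m)) / m))
    = mc / m * (1 + \<i> / 2 * (u1c * v1 + u2c * v2)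
        - \<i> * tau * (l * p - (u1c * f1 + u2c * f2)) / m)"
proof -
  define mi mci where "mi = inverse m" and "mci = inverse mc"
  let ?e = "l * p - (u1c * f1 + u2c * f2)"
  have inv: "m * mi = 1" "mc * mci = 1"
    using m by (simp_all add: mi_def mci_def)
  have ltau: "f1c * v1 + f2c * v2 - l * tau = 2 * \<i> * pc / l"
    using l unfolding tau by (simp add: field_simps power2_eq_square)
  have "m + mc = - 2 * p * pc / l"
    using ml l by (simp add: field_simps)
  then have "p * (f1c * v1 + f2c * v2 - l * tau) = - \<i> * (m + mc)"
    unfolding ltau by simp
  \<comment> \<open>The definition of tau and the relation for m + mc together eliminate
    \<open>p * pc / l\<close>, so that f^* v is traded for tau.\<close>
  then have s: "p * (f1c * v1 + f2c * v2) = p * l * tau - \<i> * (m + mc)"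
    by (simp add: algebra_simps)
  have "(u1c + 2 * p * mci * f1c) * (v1 + 2 * f1 * tau * mi)
        + (u2c + 2 * p * mci * f2c) * (v2 + 2 * f2 * tau * mi)
      = (u1c * v1 + u2c * v2) + 2 * tau * mi * (u1c * f1 + u2c * f2)
        + 2 * mci * (p * (f1c * v1 + f2c * v2)) + 4 * p * tau * mi * mci * (f1 * f1c + f2 * f2c)"
    by (simp add: algebra_simps)
  also have "\<dots> = (u1c * v1 + u2c * v2) - 2 * tau * mi * ?e - 2 * \<i> * mci * (m + mc)"
    using s inv ml null by algebra
  finally have S: "(u1c + 2 * p * mci * f1c) * (v1 + 2 * f1 * tau * mi)
        + (u2c + 2 * p * mci * f2c) * (v2 + 2 * f2 * tau * mi)
      = (u1c * v1 + u2c * v2) - 2 * tau * mi * ?e - 2 * \<i> * mci * (m + mc)" .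
  have "- 1 - \<i> / 2 * ((u1c + 2 * p * mci * f1c) * (- (mc * (v1 + 2 * f1 * tau * mi)) * mi)
        + (u2c + 2 * p * mci * f2c) * (- (mc * (v2 + 2 * f2 * tau * mi)) * mi))
      = - 1 + \<i> / 2 * mc * mi * ((u1c + 2 * p * mci * f1c) * (v1 + 2 * f1 * tau * mi)
        + (u2c + 2 * p * mci * f2c) * (v2 + 2 * f2 * tau * mi))"
    by (simp add: algebra_simps)
  also have "\<dots> = - 1 + \<i> / 2 * mc * mi * ((u1c * v1 + u2c * v2) - 2 * tau * mi * ?e)
      + (mc * mci) * (m * mi + mc * mi)"
    unfolding S by (simp add: algebra_simps)
  also have "\<dots> = mc * mi * (1 + \<i> / 2 * (u1c * v1 + u2c * v2) - \<i> * tau * ?e * mi)"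
    unfolding inv by (simp add: algebra_simps)
  finally show ?thesis
    by (simp only: divide_inverse[of _ m] divide_inverse[of _ mc] mi_def mci_def)
qed

text \<open>The left side is the quotient rule for -mc W/m. The logarithmic derivatives of mc and of
  1/m are exactly the two corrections in \<open>N'\<close>, and the coefficient of \<open>u'\<close>
  is the one in \<open>d'\<close>.\<close>

lemma dressed_t_identity:
  fixes u v f m mc W tau e ec p pc N d N' d' l u' v' :: complex
  assumes m: "m \<noteq> 0" "mc \<noteq> 0"
    and N': "- \<i> / 2 * N' = - \<i> / 2 * N + \<i> * p * ec / mc + \<i> * pc * e / m"
    and d': "- 1 - \<i> / 2 * d' = mc / m * (1 + \<i> / 2 * d - \<i> * tau * e / m)"
    and v': "v' = - (mc * W) / m"
  shows "- ((\<i> * p * ec) * W + mc * (- \<i> / 2 * N * W - (1 + \<i> / 2 * d - \<i> * tau * e / m) * u')) / m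
      + (mc * W) * (- \<i> * pc * e) / m\<^sup>2
    = - u' - \<i> / 2 * N' * v' - \<i> / 2 * d' * u'"
proof -
  have "- u' - \<i> / 2 * N' * v' - \<i> / 2 * d' * u' = (- \<i> / 2 * N') * v' + (- 1 - \<i> / 2 * d') * u'"
    by (simp add: algebra_simps)
  also have "\<dots> = - ((\<i> * p * ec) * W + mc * (- \<i> / 2 * N * W - (1 + \<i> / 2 * d - \<i> * tau * e / m) * u')) / m
      + (mc * W) * (- \<i> * pc * e) / m\<^sup>2"
    unfolding N' d' v' using m
    by (simp add: divide_simps) (simp add: algebra_simps power2_eq_square)
  finally show ?thesis ..
qed

text \<open>The nonlinearity of the system is regrouped by splitting |u1|^2 v1 into two halves: one
  completes |u|^2 v1 / 2, the other the product of u^* v / 2 with u1. The Lax pair produces this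
  symmetric form.\<close>

lemma coupled_FL_solutionI:
  assumes x: "\<And>x t. ((\<lambda>s. u1 s t) has_vector_derivative v1 x t) (at x)"
    "\<And>x t. ((\<lambda>s. u2 s t) has_vector_derivative v2 x t) (at x)"
    and t: "\<And>x t. ((\<lambda>s. v1 x s) has_vector_derivative
          - u1 x t - \<i> / 2 * (u1 x t * cnj (u1 x t) + u2 x t * cnj (u2 x t)) * v1 x t
          - \<i> / 2 * (cnj (u1 x t) * v1 x t + cnj (u2 x t) * v2 x t) * u1 x t) (at t)"
    "\<And>x t. ((\<lambda>s. v2 x s) has_vector_derivative
          - u2 x t - \<i> / 2 * (u1 x t * cnj (u1 x t) + u2 x t * cnj (u2 x t)) * v2 x t
          - \<i> / 2 * (cnj (u1 x t) * v1 x t + cnj (u2 x t) * v2 x t) * u2 x t) (at t)"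
  shows "coupled_FL_solution u1 u2"
proof -
  have V: "partial_x u1 = v1" "partial_x u2 = v2"
    using x by (simp_all add: partial_x_def vector_derivative_at fun_eq_iff)
  note V_t = t[THEN vector_derivative_at]
  have sq: "complex_of_real ((cmod z)\<^sup>2 + 1/2 * (cmod w)\<^sup>2) = z * cnj z + w * cnj w / 2" for z w
    by (simp only: of_real_add of_real_mult complex_norm_square) simp
  show ?thesis
    unfolding coupled_FL_solution_def V sq partial_t_def V_t
    by (intro allI conjI x[THEN differentiableI_vector] t[THEN differentiableI_vector])
      (simp_all add: algebra_simps)
qed

text \<open>In the next locale \<open>(p, f1, f2)\<close> is the eigenfunction \<open>(\<psi>, \<phi>)\<close>. The pivot is \<open>tau\<close>: the dressed
  derivative is \<open>- (m\<^sup>*/m) (v + 2 \<phi> tau / m)\<close>, and \<open>tau_t\<close> is again linear in \<open>tau\<close>.\<close>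

locale dressing =
  fixes u1 u2 v1 v2 p f1 f2 m :: "real \<Rightarrow> real \<Rightarrow> complex" and l :: real
    and N d e tau :: "real \<Rightarrow> real \<Rightarrow> complex"
  defines "N \<equiv> \<lambda>x t. u1 x t * cnj (u1 x t) + u2 x t * cnj (u2 x t)"
    and "d \<equiv> \<lambda>x t. cnj (u1 x t) * v1 x t + cnj (u2 x t) * v2 x t"
    and "e \<equiv> \<lambda>x t. l * p x t - (cnj (u1 x t) * f1 x t + cnj (u2 x t) * f2 x t)"
    and "tau \<equiv> \<lambda>x t. (cnj (f1 x t) * v1 x t + cnj (f2 x t) * v2 x t) / l
                 - 2 * \<i> / (of_real l)\<^sup>2 * cnj (p x t)"
  assumes l: "l \<noteq> 0" and m: "m x t \<noteq> 0"
    and u1_x: "((\<lambda>s. u1 s t) has_vector_derivative v1 x t) (at x)"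
    and u2_x: "((\<lambda>s. u2 s t) has_vector_derivative v2 x t) (at x)"
    and v1_t: "((\<lambda>s. v1 x s) has_vector_derivative
          - u1 x t - \<i> / 2 * N x t * v1 x t - \<i> / 2 * d x t * u1 x t) (at t)"
    and v2_t: "((\<lambda>s. v2 x s) has_vector_derivative
          - u2 x t - \<i> / 2 * N x t * v2 x t - \<i> / 2 * d x t * u2 x t) (at t)"
    and p_x: "((\<lambda>s. p s t) has_vector_derivative
          (cnj (v1 x t) * f1 x t + cnj (v2 x t) * f2 x t) / l + 2 * \<i> / (of_real l)\<^sup>2 * p x t) (at x)"
    and f1_x: "((\<lambda>s. f1 s t) has_vector_derivative v1 x t * p x t / l) (at x)"
    and f2_x: "((\<lambda>s. f2 s t) has_vector_derivative v2 x t * p x t / l) (at x)"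
    and m_x: "((\<lambda>s. m s t) has_vector_derivative 4 * \<i> * p x t * cnj (p x t) / of_real l ^ 3
          - 2 / (of_real l)\<^sup>2 * p x t * (cnj (f1 x t) * v1 x t + cnj (f2 x t) * v2 x t)) (at x)"
    and p_t: "((\<lambda>s. p x s) has_vector_derivative \<i> / 2 * (N x t * p x t + l * e x t)) (at t)"
    and f1_t: "((\<lambda>s. f1 x s) has_vector_derivative \<i> / 2 * e x t * u1 x t) (at t)"
    and f2_t: "((\<lambda>s. f2 x s) has_vector_derivative \<i> / 2 * e x t * u2 x t) (at t)"
    and m_t: "((\<lambda>s. m x s) has_vector_derivative - \<i> * cnj (p x t) * e x t) (at t)"
    and null: "p x t * cnj (p x t) = f1 x t * cnj (f1 x t) + f2 x t * cnj (f2 x t)"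
    and m_re: "l * (m x t + cnj (m x t)) = - 2 * p x t * cnj (p x t)"
begin

lemma dressed_x:
  assumes u_x: "((\<lambda>s. u s t) has_vector_derivative v x t) (at x)"
    and f_x: "((\<lambda>s. f s t) has_vector_derivative v x t * p x t / l) (at x)"
  shows "((\<lambda>s. u s t + 2 * cnj (p s t) / m s t * f s t) has_vector_derivative
    - (cnj (m x t) * (v x t + 2 * f x t * tau x t / m x t)) / m x t) (at x)"
proof -
  let ?s = "cnj (f1 x t) * v1 x t + cnj (f2 x t) * v2 x t"
  let ?pt = "?s / l - 2 * \<i> / (of_real l)\<^sup>2 * cnj (p x t)"
  have pc: "((\<lambda>s. cnj (p s t)) has_vector_derivative ?pt) (at x)"
    using has_vector_derivative_cnj[OF p_x[of t x]] by (simp add: mult.commute)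
  have "((\<lambda>s. 2 * (cnj (p s t) * f s t)) has_vector_derivative
      2 * (cnj (p x t) * (v x t * p x t / l) + ?pt * f x t)) (at x)"
    by (intro has_vector_derivative_mult_right has_vector_derivative_mult pc f_x)
  from has_vector_derivative_add[OF u_x has_vector_derivative_divide_complex[OF this m_x m]]
  have D: "((\<lambda>s. u s t + 2 * cnj (p s t) / m s t * f s t) has_vector_derivative
     v x t + (2 * (?pt * f x t + cnj (p x t) * (v x t * p x t / l)) / m x t
       - 2 * cnj (p x t) * f x t * (4 * \<i> * p x t * cnj (p x t) / of_real l ^ 3
          - 2 / (of_real l)\<^sup>2 * p x t * ?s) / (m x t)\<^sup>2)) (at x)"
    by (simp add: add.commute mult.assoc)
  have mc: "cnj (m x t) = - m x t - 2 * p x t * cnj (p x t) / l"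
  proof -
    have "m x t + cnj (m x t) = l * (m x t + cnj (m x t)) / l"
      using l by simp
    also have "\<dots> = - 2 * p x t * cnj (p x t) / l"
      unfolding m_re ..
    finally have "m x t + cnj (m x t) = - 2 * p x t * cnj (p x t) / l" .
    then have "cnj (m x t) = - 2 * p x t * cnj (p x t) / l - m x t"
      by (metis add_diff_cancel_left')
    then show ?thesis
      by simp
  qed
  show ?thesis
    using D unfolding dressed_x_identity[OF m mc] tau_def .
qed

lemma tau_t:
  "((\<lambda>s. tau x s) has_vector_derivative
     - \<i> / 2 * N x t * tau x t - cnj (p x t) * (1 + \<i> / 2 * d x t)) (at t)"
proof -
  let ?cc = "u1 x t * cnj (f1 x t) + u2 x t * cnj (f2 x t)"
  have ec: "cnj (e x t) = l * cnj (p x t) - ?cc"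
    by (simp add: e_def)
  have pc: "((\<lambda>s. cnj (p x s)) has_vector_derivative
      - \<i> / 2 * (N x t * cnj (p x t) + l * (l * cnj (p x t) - ?cc))) (at t)"
    using has_vector_derivative_cnj[OF p_t[of x t]] by (simp add: ec N_def mult_ac)
  have f1c: "((\<lambda>s. cnj (f1 x s)) has_vector_derivative
      - \<i> / 2 * (l * cnj (p x t) - ?cc) * cnj (u1 x t)) (at t)"
    using has_vector_derivative_cnj[OF f1_t[of x t]] by (simp add: ec)
  have f2c: "((\<lambda>s. cnj (f2 x s)) has_vector_derivative
      - \<i> / 2 * (l * cnj (p x t) - ?cc) * cnj (u2 x t)) (at t)"
    using has_vector_derivative_cnj[OF f2_t[of x t]] by (simp add: ec)
  let ?u1c = "- \<i> / 2 * (l * cnj (p x t) - ?cc) * cnj (u1 x t)"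
  let ?u2c = "- \<i> / 2 * (l * cnj (p x t) - ?cc) * cnj (u2 x t)"
  let ?v1 = "- u1 x t - \<i> / 2 * N x t * v1 x t - \<i> / 2 * d x t * u1 x t"
  let ?v2 = "- u2 x t - \<i> / 2 * N x t * v2 x t - \<i> / 2 * d x t * u2 x t"
  have D: "((\<lambda>s. (cnj (f1 x s) * v1 x s + cnj (f2 x s) * v2 x s) * (1 / of_real l)
        - 2 * \<i> / (of_real l)\<^sup>2 * cnj (p x s)) has_vector_derivative
      ((cnj (f1 x t) * ?v1 + ?u1c * v1 x t) + (cnj (f2 x t) * ?v2 + ?u2c * v2 x t)) * (1 / of_real l)
      - 2 * \<i> / (of_real l)\<^sup>2 * (- \<i> / 2 * (N x t * cnj (p x t) + l * (l * cnj (p x t) - ?cc)))) (at t)"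
    by (intro has_vector_derivative_diff has_vector_derivative_mult_left
        has_vector_derivative_mult_right has_vector_derivative_add has_vector_derivative_mult
        f1c f2c v1_t v2_t pc)
  have l': "complex_of_real l \<noteq> 0"
    using l by simp
  have "((cnj (f1 x t) * ?v1 + ?u1c * v1 x t) + (cnj (f2 x t) * ?v2 + ?u2c * v2 x t)) * (1 / of_real l)
      - 2 * \<i> / (of_real l)\<^sup>2 * (- \<i> / 2 * (N x t * cnj (p x t) + l * (l * cnj (p x t) - ?cc)))
     = ((?u1c * v1 x t + cnj (f1 x t) * ?v1) + (?u2c * v2 x t + cnj (f2 x t) * ?v2)) / of_real l
      - 2 * \<i> / (of_real l)\<^sup>2 * (- \<i> / 2 * (N x t * cnj (p x t) + l * (l * cnj (p x t) - ?cc)))"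
    by (simp add: add.commute)
  also have "\<dots> = - \<i> / 2 * N x t * tau x t - cnj (p x t) * (1 + \<i> / 2 * d x t)"
    unfolding tau_def by (rule tau_t_identity[OF l' refl]) (simp add: d_def)
  finally show ?thesis
    using D by (simp add: tau_def)
qed

lemma dressed_t:
  fixes u v f :: "real \<Rightarrow> real \<Rightarrow> complex"
  defines "W \<equiv> \<lambda>x t. v x t + 2 * f x t * tau x t / m x t"
    and "u' \<equiv> \<lambda>x t. u x t + 2 * cnj (p x t) / m x t * f x t"
  assumes v_t: "((\<lambda>s. v x s) has_vector_derivative
          - u x t - \<i> / 2 * N x t * v x t - \<i> / 2 * d x t * u x t) (at t)"
    and f_t: "((\<lambda>s. f x s) has_vector_derivative \<i> / 2 * e x t * u x t) (at t)"
  shows "((\<lambda>s. - (cnj (m x s) * W x s) / m x s) has_vector_derivative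
    - ((\<i> * p x t * cnj (e x t)) * W x t + cnj (m x t) * (- \<i> / 2 * N x t * W x t
        - (1 + \<i> / 2 * d x t - \<i> * tau x t * e x t / m x t) * u' x t)) / m x t
      + (cnj (m x t) * W x t) * (- \<i> * cnj (p x t) * e x t) / (m x t)\<^sup>2) (at t)"
proof -
  have "((\<lambda>s. 2 * (f x s * tau x s)) has_vector_derivative
      2 * (f x t * (- \<i> / 2 * N x t * tau x t - cnj (p x t) * (1 + \<i> / 2 * d x t))
        + (\<i> / 2 * e x t * u x t) * tau x t)) (at t)"
    by (intro has_vector_derivative_mult_right has_vector_derivative_mult f_t tau_t)
  from has_vector_derivative_add[OF v_t has_vector_derivative_divide_complex[OF this m_t[of x t] m[of x t]]]
  have "((\<lambda>s. W x s) has_vector_derivative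
     (- u x t - \<i> / 2 * N x t * v x t - \<i> / 2 * d x t * u x t)
      + (2 * ((\<i> / 2 * e x t * u x t) * tau x t
            + f x t * (- \<i> / 2 * N x t * tau x t - cnj (p x t) * (1 + \<i> / 2 * d x t))) / m x t
          - 2 * f x t * tau x t * (- \<i> * cnj (p x t) * e x t) / (m x t)\<^sup>2)) (at t)"
    unfolding W_def by (simp add: add.commute mult.assoc)
  then have W_t: "((\<lambda>s. W x s) has_vector_derivative - \<i> / 2 * N x t * W x t
        - (1 + \<i> / 2 * d x t - \<i> * tau x t * e x t / m x t) * u' x t) (at t)"
    unfolding W_t_identity by (simp only: W_def u'_def)
  have mc: "((\<lambda>s. cnj (m x s)) has_vector_derivative \<i> * p x t * cnj (e x t)) (at t)"
    using has_vector_derivative_cnj[OF m_t[of x t]] by simp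
  have eq: "(\<lambda>s. - (cnj (m x s) * W x s) / m x s) = (\<lambda>s. - (cnj (m x s) * W x s / m x s))"
    by simp
  show ?thesis
    unfolding eq
    by (rule has_vector_derivative_eq_rhs[OF has_vector_derivative_minus[OF
            has_vector_derivative_divide_complex[OF has_vector_derivative_mult[OF mc W_t]
              m_t[of x t] m[of x t]]]])
      (simp add: algebra_simps add_divide_distrib diff_divide_distrib)
qed

lemma dressed_pair_solution:
  "coupled_FL_solution (\<lambda>x t. u1 x t + 2 * cnj (p x t) / m x t * f1 x t)
     (\<lambda>x t. u2 x t + 2 * cnj (p x t) / m x t * f2 x t)"
    (is "coupled_FL_solution ?U1 ?U2")
proof -
  define V1 where "V1 = (\<lambda>x t. - (cnj (m x t) * (v1 x t + 2 * f1 x t * tau x t / m x t)) / m x t)"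
  define V2 where "V2 = (\<lambda>x t. - (cnj (m x t) * (v2 x t + 2 * f2 x t * tau x t / m x t)) / m x t)"
  let ?N = "\<lambda>x t. ?U1 x t * cnj (?U1 x t) + ?U2 x t * cnj (?U2 x t)"
  let ?d = "\<lambda>x t. cnj (?U1 x t) * V1 x t + cnj (?U2 x t) * V2 x t"
  have x: "((\<lambda>s. ?U1 s t) has_vector_derivative V1 x t) (at x)"
    "((\<lambda>s. ?U2 s t) has_vector_derivative V2 x t) (at x)" for x t
    unfolding V1_def V2_def by (intro dressed_x u1_x f1_x u2_x f2_x)+
  have mc: "cnj (m x t) \<noteq> 0" for x t
    using m by simp
  have N': "- \<i> / 2 * ?N x t = - \<i> / 2 * N x t + \<i> * p x t * cnj (e x t) / cnj (m x t)
      + \<i> * cnj (p x t) * e x t / m x t" for x t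
    using N_dressed_identity[OF m[of x t] mc[of x t] m_re[of x t] null[of x t],
        of "u1 x t" "cnj (u1 x t)" "u2 x t" "cnj (u2 x t)"]
    by (simp add: N_def e_def)
  have l': "complex_of_real l \<noteq> 0"
    using l by simp
  have tau_eq: "tau x t = (cnj (f1 x t) * v1 x t + cnj (f2 x t) * v2 x t) / l
      - 2 * \<i> / (of_real l)\<^sup>2 * cnj (p x t)" for x t
    by (simp add: tau_def)
  have d': "- 1 - \<i> / 2 * ?d x t = cnj (m x t) / m x t * (1 + \<i> / 2 * d x t
      - \<i> * tau x t * e x t / m x t)" for x t
    using d_dressed_identity[OF l' m[of x t] mc[of x t] m_re[of x t] null[of x t]
        tau_eq[of x t],
        of "cnj (u1 x t)" "cnj (u2 x t)"]
    by (simp add: V1_def V2_def d_def e_def)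
  have t1: "((\<lambda>s. V1 x s) has_vector_derivative
      - ?U1 x t - \<i> / 2 * ?N x t * V1 x t - \<i> / 2 * ?d x t * ?U1 x t) (at t)" for x t
    using dressed_t[where u = u1 and v = v1 and f = f1 and x = x and t = t, OF v1_t f1_t]
    unfolding dressed_t_identity[OF m mc N' d' refl] V1_def .
  have t2: "((\<lambda>s. V2 x s) has_vector_derivative
      - ?U2 x t - \<i> / 2 * ?N x t * V2 x t - \<i> / 2 * ?d x t * ?U2 x t) (at t)" for x t
    using dressed_t[where u = u2 and v = v2 and f = f2 and x = x and t = t, OF v2_t f2_t]
    unfolding dressed_t_identity[OF m mc N' d' refl] V2_def .
  show ?thesis
    by (rule coupled_FL_solutionI[OF x t1 t2])
qed

end

section \<open>Lax chains and the norming function\<close>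

text \<open>The indefinite form <(q, g1, g2)|J|(p, f1, f2)> in components.\<close>

definition pairing :: "complex \<Rightarrow> complex \<Rightarrow> complex \<Rightarrow> complex \<Rightarrow> complex \<Rightarrow> complex \<Rightarrow> complex" where
  "pairing q g1 g2 p f1 f2 = cnj q * p - cnj g1 * f1 - cnj g2 * f2"

lemma has_vector_derivative_pairing:
  assumes "(q has_vector_derivative q') (at s)" "(g1 has_vector_derivative g1') (at s)"
    "(g2 has_vector_derivative g2') (at s)" "(p has_vector_derivative p') (at s)"
    "(f1 has_vector_derivative f1') (at s)" "(f2 has_vector_derivative f2') (at s)"
  shows "((\<lambda>s. pairing (q s) (g1 s) (g2 s) (p s) (f1 s) (f2 s)) has_vector_derivative
    pairing q' g1' g2' (p s) (f1 s) (f2 s) + pairing (q s) (g1 s) (g2 s) p' f1' f2') (at s)"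
  unfolding pairing_def
  by (rule has_vector_derivative_eq_rhs[OF has_vector_derivative_diff[OF
          has_vector_derivative_diff[OF
            has_vector_derivative_mult[OF has_vector_derivative_cnj[OF assms(1)] assms(4)]
            has_vector_derivative_mult[OF has_vector_derivative_cnj[OF assms(2)] assms(5)]]
          has_vector_derivative_mult[OF has_vector_derivative_cnj[OF assms(3)] assms(6)]]])
    simp

lemma pairing_add_left:
  "pairing (q + q') (g1 + g1') (g2 + g2') p f1 f2 = pairing q g1 g2 p f1 f2 + pairing q' g1' g2' p f1 f2"
  by (simp add: pairing_def algebra_simps)

text \<open>If the homogeneous parts of the derivatives cancel, only the inhomogeneity of the left
  vector survives. This reduces the derivative of \<open>Omega\<close> to a quadratic expression in
  the eigenfunction.\<close>

lemma pairing_split_left: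
  assumes "pairing q g1 g2 p f1 f2 + pairing r r1 r2 p' f1' f2' = 0"
  shows "pairing (q + q') (g1 + g1') (g2 + g2') p f1 f2 + pairing r r1 r2 p' f1' f2'
    = pairing q' g1' g2' p f1 f2"
  using assms unfolding pairing_add_left by algebra

text \<open>The spatial Lax matrix is anti-Hermitian for J: the sign of J on the lower components
  cancels the off-diagonal terms in pairs, and the diagonal is imaginary.\<close>

lemma pairing_lax_x:
  fixes l :: real
  shows "pairing ((cnj v1 * g1 + cnj v2 * g2) / l + 2 * \<i> / (of_real l)\<^sup>2 * q)
      (v1 * q / l) (v2 * q / l) p f1 f2
    + pairing q g1 g2 ((cnj v1 * f1 + cnj v2 * f2) / l + 2 * \<i> / (of_real l)\<^sup>2 * p)
      (v1 * p / l) (v2 * p / l) = 0"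
  unfolding pairing_def by (simp add: algebra_simps add_divide_distrib)

definition lax_e :: "real \<Rightarrow> complex \<Rightarrow> complex \<Rightarrow> complex \<Rightarrow> complex \<Rightarrow> complex \<Rightarrow> complex" where
  "lax_e l u1 u2 p f1 f2 = l * p - (cnj u1 * f1 + cnj u2 * f2)"

lemma pairing_lax_t:
  assumes N: "cnj N = N"
  shows "pairing (\<i> / 2 * (N * q + of_real l * lax_e l u1 u2 q g1 g2))
      (\<i> / 2 * lax_e l u1 u2 q g1 g2 * u1) (\<i> / 2 * lax_e l u1 u2 q g1 g2 * u2) p f1 f2
    + pairing q g1 g2 (\<i> / 2 * (N * p + of_real l * lax_e l u1 u2 p f1 f2))
      (\<i> / 2 * lax_e l u1 u2 p f1 f2 * u1) (\<i> / 2 * lax_e l u1 u2 p f1 f2 * u2) = 0"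
  unfolding pairing_def lax_e_def
  by (simp add: N) (simp add: algebra_simps add_divide_distrib diff_divide_distrib)

text \<open>With mu = l^2, the derivatives of 1/l and 2i/l^2 in mu are -1/(2 l^3) and -2i/l^4. The
  result is purely imaginary: an imaginary multiple of |p|^2 minus a real multiple of a difference
  of conjugates.\<close>

lemma pairing_lax_x_mu:
  fixes l :: real
  shows "pairing (- (cnj v1 * f1 + cnj v2 * f2) / (2 * of_real l ^ 3) - 2 * \<i> / of_real l ^ 4 * p)
      (- v1 * p / (2 * of_real l ^ 3)) (- v2 * p / (2 * of_real l ^ 3)) p f1 f2
    = 2 * \<i> / of_real l ^ 4 * (p * cnj p)
      - (p * (cnj f1 * v1 + cnj f2 * v2) - cnj p * (cnj v1 * f1 + cnj v2 * f2)) / (2 * of_real l ^ 3)"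
  by (simp add: pairing_def algebra_simps add_divide_distrib diff_divide_distrib)

text \<open>Here the derivatives in mu of i mu/2 and i l/2 are i/2 and i/(4 l). The result is again
  imaginary, since a number and its conjugate are added.\<close>

lemma pairing_lax_t_mu:
  fixes l :: real
  assumes "l \<noteq> 0"
  shows "pairing (\<i> / 2 * p - \<i> / (4 * of_real l) * (cnj u1 * f1 + cnj u2 * f2))
      (\<i> / (4 * of_real l) * u1 * p) (\<i> / (4 * of_real l) * u2 * p) p f1 f2
    = - \<i> / (4 * of_real l) * (cnj p * lax_e l u1 u2 p f1 f2 + p * cnj (lax_e l u1 u2 p f1 f2))"
proof -
  define w where "w = \<i> / (4 * complex_of_real l)"
  have w: "cnj w = - w" "\<i> / 2 = 2 * l * w" "- \<i> / (4 * complex_of_real l) = - w"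
    using assms by (simp_all add: w_def)
  show ?thesis
    unfolding w_def[symmetric] w pairing_def lax_e_def
    by (simp add: w algebra_simps)
qed

text \<open>\<open>(q, g1, g2)\<close> solves the Lax pair for \<open>(p, f1, f2)\<close> differentiated in \<open>\<mu> = l\<^sup>2\<close>; the added
  inhomogeneities are the \<open>\<mu>\<close>-derivatives of the Lax matrices applied to \<open>(p, f1, f2)\<close>.\<close>

locale lax_chain =
  fixes u1 u2 v1 v2 p f1 f2 q g1 g2 :: "real \<Rightarrow> real \<Rightarrow> complex" and l :: real and zeta :: complex
    and N d e eq :: "real \<Rightarrow> real \<Rightarrow> complex"
  defines "N \<equiv> \<lambda>x t. u1 x t * cnj (u1 x t) + u2 x t * cnj (u2 x t)"
    and "d \<equiv> \<lambda>x t. cnj (u1 x t) * v1 x t + cnj (u2 x t) * v2 x t"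
    and "e \<equiv> \<lambda>x t. lax_e l (u1 x t) (u2 x t) (p x t) (f1 x t) (f2 x t)"
    and "eq \<equiv> \<lambda>x t. lax_e l (u1 x t) (u2 x t) (q x t) (g1 x t) (g2 x t)"
  assumes l_nonzero: "l \<noteq> 0" and zeta: "zeta \<notin> \<real>" and p: "p x t \<noteq> 0"
    and u1_x: "((\<lambda>s. u1 s t) has_vector_derivative v1 x t) (at x)"
    and u2_x: "((\<lambda>s. u2 s t) has_vector_derivative v2 x t) (at x)"
    and v1_t: "((\<lambda>s. v1 x s) has_vector_derivative
          - u1 x t - \<i> / 2 * N x t * v1 x t - \<i> / 2 * d x t * u1 x t) (at t)"
    and v2_t: "((\<lambda>s. v2 x s) has_vector_derivative
          - u2 x t - \<i> / 2 * N x t * v2 x t - \<i> / 2 * d x t * u2 x t) (at t)"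
    and p_x: "((\<lambda>s. p s t) has_vector_derivative
          (cnj (v1 x t) * f1 x t + cnj (v2 x t) * f2 x t) / l + 2 * \<i> / (of_real l)\<^sup>2 * p x t) (at x)"
    and f1_x: "((\<lambda>s. f1 s t) has_vector_derivative v1 x t * p x t / l) (at x)"
    and f2_x: "((\<lambda>s. f2 s t) has_vector_derivative v2 x t * p x t / l) (at x)"
    and p_t: "((\<lambda>s. p x s) has_vector_derivative \<i> / 2 * (N x t * p x t + l * e x t)) (at t)"
    and f1_t: "((\<lambda>s. f1 x s) has_vector_derivative \<i> / 2 * e x t * u1 x t) (at t)"
    and f2_t: "((\<lambda>s. f2 x s) has_vector_derivative \<i> / 2 * e x t * u2 x t) (at t)"
    and q_x: "((\<lambda>s. q s t) has_vector_derivative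
          ((cnj (v1 x t) * g1 x t + cnj (v2 x t) * g2 x t) / l + 2 * \<i> / (of_real l)\<^sup>2 * q x t)
          + (- (cnj (v1 x t) * f1 x t + cnj (v2 x t) * f2 x t) / (2 * of_real l ^ 3)
             - 2 * \<i> / of_real l ^ 4 * p x t)) (at x)"
    and g1_x: "((\<lambda>s. g1 s t) has_vector_derivative
          v1 x t * q x t / l + (- v1 x t * p x t / (2 * of_real l ^ 3))) (at x)"
    and g2_x: "((\<lambda>s. g2 s t) has_vector_derivative
          v2 x t * q x t / l + (- v2 x t * p x t / (2 * of_real l ^ 3))) (at x)"
    and q_t: "((\<lambda>s. q x s) has_vector_derivative \<i> / 2 * (N x t * q x t + l * eq x t)
          + (\<i> / 2 * p x t - \<i> / (4 * of_real l) * (cnj (u1 x t) * f1 x t + cnj (u2 x t) * f2 x t))) (at t)"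
    and g1_t: "((\<lambda>s. g1 x s) has_vector_derivative \<i> / 2 * eq x t * u1 x t
          + \<i> / (4 * of_real l) * u1 x t * p x t) (at t)"
    and g2_t: "((\<lambda>s. g2 x s) has_vector_derivative \<i> / 2 * eq x t * u2 x t
          + \<i> / (4 * of_real l) * u2 x t * p x t) (at t)"
    and null: "p x t * cnj (p x t) = f1 x t * cnj (f1 x t) + f2 x t * cnj (f2 x t)"
begin

definition Omega :: "real \<Rightarrow> real \<Rightarrow> complex" where
  "Omega x t = pairing (q x t) (g1 x t) (g2 x t) (p x t) (f1 x t) (f2 x t)"

text \<open>As Omega has imaginary derivatives, Re Omega is constant. Expanding the quotient gives m
  = 2 i l Im Omega + 2 i l (Re zeta / Im zeta) Re Omega - |p|^2 / l, so zeta only selects an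
  imaginary constant of integration.\<close>

definition m :: "real \<Rightarrow> real \<Rightarrow> complex" where
  "m x t = of_real (2 * l) / (cnj zeta - zeta) * (cnj zeta * Omega x t + zeta * cnj (Omega x t))
     - p x t * cnj (p x t) / l"

lemma zeta_diff: "cnj zeta - zeta \<noteq> 0"
  using zeta by (simp add: Reals_cnj_iff)

lemma Omega_x: "((\<lambda>s. Omega s t) has_vector_derivative
    2 * \<i> / of_real l ^ 4 * (p x t * cnj (p x t))
    - (p x t * (cnj (f1 x t) * v1 x t + cnj (f2 x t) * v2 x t)
       - cnj (p x t) * (cnj (v1 x t) * f1 x t + cnj (v2 x t) * f2 x t)) / (2 * of_real l ^ 3)) (at x)"
  unfolding Omega_def
  by (rule has_vector_derivative_eq_rhs[OF has_vector_derivative_pairing[OF q_x g1_x g2_x p_x f1_x f2_x]])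
    (rule trans[OF pairing_split_left[OF pairing_lax_x] pairing_lax_x_mu])

lemma Omega_t: "((\<lambda>s. Omega x s) has_vector_derivative
    - \<i> / (4 * of_real l) * (cnj (p x t) * e x t + p x t * cnj (e x t))) (at t)"
proof -
  have N: "cnj (N x t) = N x t"
    by (simp add: N_def mult.commute)
  show ?thesis
    unfolding Omega_def e_def
    by (rule has_vector_derivative_eq_rhs[OF has_vector_derivative_pairing[OF
            q_t g1_t g2_t p_t f1_t f2_t]])
      (unfold e_def eq_def, rule trans[OF pairing_split_left[OF pairing_lax_t[OF N]] pairing_lax_t_mu[OF l_nonzero]])
qed

lemma norm_p_x: "((\<lambda>s. p s t * cnj (p s t)) has_vector_derivative
    (cnj (p x t) * (cnj (v1 x t) * f1 x t + cnj (v2 x t) * f2 x t)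
     + p x t * (cnj (f1 x t) * v1 x t + cnj (f2 x t) * v2 x t)) / l) (at x)"
  by (rule has_vector_derivative_eq_rhs[OF has_vector_derivative_mult[OF p_x
          has_vector_derivative_cnj[OF p_x]]])
    (simp add: algebra_simps add_divide_distrib)

lemma norm_p_t: "((\<lambda>s. p x s * cnj (p x s)) has_vector_derivative
    \<i> * l / 2 * (cnj (p x t) * e x t - p x t * cnj (e x t))) (at t)"
  by (rule has_vector_derivative_eq_rhs[OF has_vector_derivative_mult[OF p_t
          has_vector_derivative_cnj[OF p_t]]])
    (simp add: N_def algebra_simps)

text \<open>For imaginary D the bracket becomes (cnj zeta - zeta) D and cancels the denominator;
  here zeta disappears.\<close>

lemma m_deriv:
  fixes D n' :: complex and \<Omega> n :: "real \<Rightarrow> complex"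
  assumes "(\<Omega> has_vector_derivative D) (at s)" and "cnj D = - D"
    and "(n has_vector_derivative n') (at s)"
  shows "((\<lambda>s. of_real (2 * l) / (cnj zeta - zeta) * (cnj zeta * \<Omega> s + zeta * cnj (\<Omega> s)) - n s / l)
    has_vector_derivative 2 * l * D - n' / l) (at s)"
proof -
  have "((\<lambda>s. of_real (2 * l) / (cnj zeta - zeta) * (cnj zeta * \<Omega> s + zeta * cnj (\<Omega> s)) - n s * (1 / l))
    has_vector_derivative of_real (2 * l) / (cnj zeta - zeta) * (cnj zeta * D + zeta * cnj D) - n' * (1 / l)) (at s)"
    by (intro has_vector_derivative_diff has_vector_derivative_mult_right
        has_vector_derivative_mult_left has_vector_derivative_add has_vector_derivative_cnj assms)
  moreover have "cnj zeta * D + zeta * cnj D = (cnj zeta - zeta) * D"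
    unfolding assms(2) by (simp add: algebra_simps)
  ultimately show ?thesis
    using zeta_diff by (simp add: mult.assoc)
qed

lemma m_x: "((\<lambda>s. m s t) has_vector_derivative 4 * \<i> * p x t * cnj (p x t) / of_real l ^ 3
          - 2 / (of_real l)\<^sup>2 * p x t * (cnj (f1 x t) * v1 x t + cnj (f2 x t) * v2 x t)) (at x)"
proof -
  define X Y Z where "X = p x t * cnj (p x t)"
    and "Y = p x t * (cnj (f1 x t) * v1 x t + cnj (f2 x t) * v2 x t)"
    and "Z = cnj (p x t) * (cnj (v1 x t) * f1 x t + cnj (v2 x t) * f2 x t)"
  have cnj: "cnj X = X" "cnj Y = Z" "cnj Z = Y"
    by (simp_all add: X_def Y_def Z_def mult.commute)
  let ?D = "2 * \<i> / of_real l ^ 4 * X - (Y - Z) / (2 * of_real l ^ 3)"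
  have "cnj ?D = - (2 * \<i> / of_real l ^ 4 * X) - (Z - Y) / (2 * of_real l ^ 3)"
    by (simp add: cnj)
  also have "\<dots> = - ?D"
    by (simp add: diff_divide_distrib)
  finally have "((\<lambda>s. m s t) has_vector_derivative 2 * l * ?D - (Z + Y) / l / l) (at x)"
    unfolding m_def
    by (intro m_deriv Omega_x[of t x, folded X_def Y_def Z_def] norm_p_x[of t x, folded Y_def Z_def])
  \<comment> \<open>The summand -|p|^2 / l of m is what removes \<open>Z\<close> and doubles
    \<open>Y\<close>; in \<open>m_t\<close> it acts in the same way.\<close>
  also have "2 * l * ?D - (Z + Y) / l / l = 4 * \<i> * X / of_real l ^ 3 - 2 / (of_real l)\<^sup>2 * Y"
    using l_nonzero by (simp add: field_simps power2_eq_square power3_eq_cube power4_eq_xxxx)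
  finally show ?thesis
    by (simp add: X_def Y_def mult.assoc)
qed

lemma m_t: "((\<lambda>s. m x s) has_vector_derivative - \<i> * cnj (p x t) * e x t) (at t)"
proof -
  define Y Z where "Y = cnj (p x t) * e x t" and "Z = p x t * cnj (e x t)"
  have cnj: "cnj Y = Z" "cnj Z = Y"
    by (simp_all add: Y_def Z_def)
  let ?D = "- \<i> / (4 * of_real l) * (Y + Z)"
  have "cnj ?D = - ?D"
    by (simp add: cnj add.commute)
  then have "((\<lambda>s. m x s) has_vector_derivative 2 * l * ?D - (\<i> * l / 2 * (Y - Z)) / l) (at t)"
    unfolding m_def
    by (intro m_deriv Omega_t[of x t, folded Y_def Z_def] norm_p_t[of x t, folded Y_def Z_def])
  also have "2 * l * ?D - (\<i> * l / 2 * (Y - Z)) / l = - \<i> * Y"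
    using l_nonzero by (simp add: field_simps)
  finally show ?thesis
    by (simp add: Y_def mult.assoc)
qed

text \<open>The bracket containing zeta is real and its prefactor imaginary, so only -|p|^2 / l
  contributes.\<close>

lemma m_re: "l * (m x t + cnj (m x t)) = - 2 * p x t * cnj (p x t)"
proof -
  have "m x t + cnj (m x t) = - 2 * p x t * cnj (p x t) / l"
  proof -
    let ?X = "cnj zeta * Omega x t + zeta * cnj (Omega x t)"
    have "cnj ?X = ?X"
      by (simp add: add.commute)
    then have "cnj (m x t) = of_real (2 * l) / (zeta - cnj zeta) * ?X - p x t * cnj (p x t) / l"
      by (simp add: m_def mult.commute)
    also have "of_real (2 * l) / (zeta - cnj zeta) = - (of_real (2 * l) / (cnj zeta - zeta))"
      by (metis minus_diff_eq minus_divide_right)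
    finally show ?thesis
      by (simp add: m_def)
  qed
  then show ?thesis
    using l_nonzero by simp
qed

lemma m_nonzero: "m x t \<noteq> 0"
  using m_re[of x t] p[of x t] l_nonzero by auto

lemma solution:
  "coupled_FL_solution (\<lambda>x t. u1 x t + 2 * cnj (p x t) / m x t * f1 x t)
     (\<lambda>x t. u2 x t + 2 * cnj (p x t) / m x t * f2 x t)"
proof -
  interpret dressing u1 u2 v1 v2 p f1 f2 m l N d e
    "\<lambda>x t. (cnj (f1 x t) * v1 x t + cnj (f2 x t) * v2 x t) / l
                 - 2 * \<i> / (of_real l)\<^sup>2 * cnj (p x t)"
    using l_nonzero m_nonzero u1_x u2_x v1_t v2_t p_x f1_x f2_x m_x p_t f1_t f2_t m_t null m_re
    unfolding N_def d_def e_def lax_e_def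
    by unfold_locales
  show ?thesis
    by (rule dressed_pair_solution)
qed

end

section \<open>Spectral data at the triple root\<close>

lemma triple_root_parameters:
  fixes A B k :: real and chi0 mu0 :: complex
  assumes "A > 0" "B > 0" "k \<noteq> 0"
    and cubic: "\<And>chi. spatial_cubic A B k chi mu0 = mu0 * (chi - chi0) ^ 3"
  obtains c where "chi0 = of_real c" "0 < c" "c < \<bar>k\<bar>" "mu0 = of_real (2 / (3 * c))"
    "A = (k + c) ^ 3 / (3 * c * k ^ 3)" "B = (k - c) ^ 3 / (3 * c * k ^ 3)"
proof -
  let ?k = "complex_of_real k" and ?S = "complex_of_real (A + B)" and ?R = "complex_of_real (A - B)"
  \<comment> \<open>Both sides have leading coefficient mu0, so the values at 0, 1 and -1 encode the
    remaining coefficients; \<open>sum\<close> and \<open>pairs\<close> are the Vieta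
    relations.\<close>
  have c0: "?k\<^sup>2 * (2 - ?k * ?R) = - mu0 * chi0 ^ 3"
    using cubic[of 0] by (simp add: spatial_cubic_def)
  have c1: "mu0 - 2 + ?k\<^sup>2 * (?S - mu0) + ?k\<^sup>2 * (2 - ?k * ?R) = mu0 * (1 - chi0) ^ 3"
    using cubic[of 1] by (simp add: spatial_cubic_def)
  have c2: "- mu0 - 2 - ?k\<^sup>2 * (?S - mu0) + ?k\<^sup>2 * (2 - ?k * ?R) = mu0 * (- 1 - chi0) ^ 3"
    using cubic[of "-1"] by (simp add: spatial_cubic_def)
  have "2 * (3 * mu0 * chi0) = 2 * 2"
    using c0 c1 c2 by algebra
  then have sum: "3 * mu0 * chi0 = 2"
    by (subst (asm) mult_left_cancel) simp_all
  have "2 * (3 * mu0 * chi0\<^sup>2) = 2 * (?k\<^sup>2 * (?S - mu0))"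
    using c0 c1 c2 by algebra
  then have pairs: "3 * mu0 * chi0\<^sup>2 = ?k\<^sup>2 * (?S - mu0)"
    by (subst (asm) mult_left_cancel) simp_all
  have k: "?k \<noteq> 0" and S: "?S \<noteq> 0"
    using assms by (simp_all flip: of_real_add)
  have chi0: "chi0 \<noteq> 0"
    using sum by auto
  have mu0: "mu0 = 2 / (3 * chi0)"
    using sum chi0 by (simp add: field_simps)
  have sq: "2 * chi0\<^sup>2 = 3 * (?k\<^sup>2 * (?k * ?R - 2))"
    using c0 sum by algebra
  have lin: "3 * (?k\<^sup>2 * ?S) * chi0 = 6 * chi0\<^sup>2 + 2 * ?k\<^sup>2"
    using pairs sum by algebra
  \<comment> \<open>Eliminating chi0^2 between \<open>sq\<close> and \<open>lin\<close> leaves an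
    equation that is linear in chi0 with real coefficients, and \<open>c\<close> is its solution.
    This is why the triple root is real.\<close>
  define c where "c = (9 * (k\<^sup>2 * (k * (A - B) - 2)) + 2 * k\<^sup>2) / (3 * k\<^sup>2 * (A + B))"
  have "3 * (?k\<^sup>2 * ?S) * chi0 = 9 * (?k\<^sup>2 * (?k * ?R - 2)) + 2 * ?k\<^sup>2"
    using lin sq by algebra
  then have "chi0 = (9 * (?k\<^sup>2 * (?k * ?R - 2)) + 2 * ?k\<^sup>2) / (3 * (?k\<^sup>2 * ?S))"
    using k S by (simp only: eq_divide_eq mult.commute[of chi0]) simp
  then have chi0_c: "chi0 = of_real c"
    by (simp add: c_def mult.assoc)
  have "complex_of_real (3 * (k\<^sup>2 * (A + B)) * c) = of_real (6 * c\<^sup>2 + 2 * k\<^sup>2)"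
    using lin unfolding chi0_c by simp
  then have lin_c: "3 * (k\<^sup>2 * (A + B)) * c = 6 * c\<^sup>2 + 2 * k\<^sup>2"
    by (simp only: of_real_eq_iff)
  have "complex_of_real (2 * c\<^sup>2) = of_real (3 * (k\<^sup>2 * (k * (A - B) - 2)))"
    using sq unfolding chi0_c by simp
  then have sq_c: "2 * c\<^sup>2 = 3 * (k\<^sup>2 * (k * (A - B) - 2))"
    by (simp only: of_real_eq_iff)
  have "0 < 3 * (k\<^sup>2 * (A + B)) * c"
    unfolding lin_c using assms(3) by (simp add: add_nonneg_pos)
  moreover have "0 < 3 * (k\<^sup>2 * (A + B))"
    using assms by simp
  ultimately have c_pos: "0 < c"
    by (rule zero_less_mult_pos)
  have "2 * (A * (3 * c * k ^ 3)) = 2 * (k + c) ^ 3" "2 * (B * (3 * c * k ^ 3)) = 2 * (k - c) ^ 3"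
    using lin_c sq_c by algebra+
  then have AB: "A * (3 * c * k ^ 3) = (k + c) ^ 3" "B * (3 * c * k ^ 3) = (k - c) ^ 3"
    by simp_all
  then have A: "A = (k + c) ^ 3 / (3 * c * k ^ 3)" and B: "B = (k - c) ^ 3 / (3 * c * k ^ 3)"
    using assms(3) c_pos by (simp_all add: field_simps)
  \<comment> \<open>The cubes in \<open>AB\<close> turn the signs of A and B into signs of k + c and
    k - c; positivity of B decides the case k > 0, that of A the case k < 0.\<close>
  have "c < \<bar>k\<bar>"
  proof (cases "k > 0")
    case True
    then have "0 < 3 * c * k ^ 3"
      using c_pos by simp
    moreover have "0 < B * (3 * c * k ^ 3)"
      using calculation assms(2) by simp
    ultimately have "0 < (k - c) ^ 3"
      unfolding AB by simp
    then show ?thesis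
      using True by (simp add: zero_less_power_eq)
  next
    case False
    then have "k < 0"
      using assms(3) by simp
    then have "3 * c * k ^ 3 < 0"
      using c_pos by (simp add: mult_less_0_iff power_less_zero_eq)
    moreover have "A * (3 * c * k ^ 3) < 0"
      using calculation assms(1) by (simp add: mult_less_0_iff)
    ultimately have "(k + c) ^ 3 < 0"
      unfolding AB by simp
    then show ?thesis
      using \<open>k < 0\<close> by (simp add: power_less_zero_eq)
  qed
  with chi0_c c_pos mu0 A B show ?thesis
    by (intro that[of c]) simp_all
qed

context exponential_jets
begin

lemma jet_comb_cube:
  assumes "g holomorphic_on S"
  shows "jet_comb (Suc (Suc (Suc d))) c (\<lambda>w. (w - z) ^ 3 * g w) x t
    = jet_comb d (\<lambda>n. of_nat (Suc n) * of_nat (Suc (Suc n)) * of_nat (Suc (Suc (Suc n)))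
        * c (Suc (Suc (Suc n)))) g x t"
proof -
  have "jet_comb (Suc (Suc (Suc d))) c (\<lambda>w. (w - z) ^ 3 * g w) x t
      = jet_comb (Suc (Suc (Suc d))) c (\<lambda>w. (w - z) * ((w - z) * ((w - z) * g w))) x t"
    by (simp add: power3_eq_cube mult.assoc)
  also have "\<dots> = jet_comb d (\<lambda>n. of_nat (Suc n) * of_nat (Suc (Suc n)) * of_nat (Suc (Suc (Suc n)))
        * c (Suc (Suc (Suc n)))) g x t"
    using assms by (simp add: jet_comb_lower holomorphic_intros mult.assoc del: of_nat_Suc)
  finally show ?thesis .
qed

end

lemma (in exponential_jets) jet_comb_diff:
  assumes "f holomorphic_on S" "g holomorphic_on S"
  shows "jet_comb d c (\<lambda>w. f w - g w) x t = jet_comb d c f x t - jet_comb d c g x t"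
  using jet_comb_add[OF assms(1), of "\<lambda>w. (-1) * g w" d c x t] jet_comb_cmult[OF assms(2), of d c "-1" x t]
    assms(2) by (simp add: holomorphic_intros)

lemma half_identity:
  fixes h s v y :: complex
  assumes "2 * v * h - (2 * v - s - 2 * y * h) = 0"
  shows "v * h = v - s / 2 - y * h"
proof -
  have "2 * (v * h) = 2 * (v - s / 2 - y * h)"
    using assms by (simp add: algebra_simps)
  then show ?thesis
    by (subst (asm) mult_left_cancel) simp_all
qed

locale triple_root =
  fixes A B k a1 a2 c l :: real
  assumes k: "k \<noteq> 0" and c: "0 < c" "c < \<bar>k\<bar>" and l: "0 < l" and l2: "l\<^sup>2 = 2 / (3 * c)"
    and a: "a1\<^sup>2 = A" "a2\<^sup>2 = B"
    and A: "A = (k + c) ^ 3 / (3 * c * k ^ 3)" and B: "B = (k - c) ^ 3 / (3 * c * k ^ 3)"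
    and cubic: "\<And>w. spatial_cubic A B k w (of_real (l\<^sup>2)) = of_real (l\<^sup>2) * (w - of_real c) ^ 3"
begin

definition S :: "complex set" where
  "S = - {0, of_real k, - of_real k}"

lemma c_in_S: "of_real c \<in> S"
proof -
  have "c \<noteq> 0" "c \<noteq> k" "c \<noteq> - k"
    using c by auto
  then show ?thesis
    by (auto simp: S_def of_real_eq_iff simp flip: of_real_minus)
qed

lemma S_nonzero:
  assumes "w \<in> S"
  shows "w \<noteq> 0" "of_real k + w \<noteq> 0" "of_real k - w \<noteq> 0" "w\<^sup>2 - (of_real k)\<^sup>2 \<noteq> 0"
proof -
  have w: "w \<noteq> 0" "w \<noteq> of_real k" "w \<noteq> - of_real k"
    using assms unfolding S_def by blast+
  show "w \<noteq> 0"
    by (rule w)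
  show kp: "of_real k + w \<noteq> 0"
    using w(3) by (metis add_eq_0_iff)
  show km: "of_real k - w \<noteq> 0"
    using w(2) by (metis eq_iff_diff_eq_0)
  have "w\<^sup>2 - (of_real k)\<^sup>2 = - ((of_real k + w) * (of_real k - w))"
    by (simp add: algebra_simps power2_eq_square)
  then show "w\<^sup>2 - (of_real k)\<^sup>2 \<noteq> 0"
    using kp km by (simp only: neg_equal_0_iff_equal mult_eq_0_iff de_Morgan_disj not_False_eq_True)
qed

text \<open>\<open>r\<close> and \<open>r'\<close> are the cofactors of F in the spatial and the
  temporal Lax equation, the inverses of the common denominators of \<open>h1\<close>,
  \<open>h2\<close> and of \<open>h1\<close>, \<open>h2\<close>, \<open>nu\<close>.\<close>

definition r where "r w = inverse (w\<^sup>2 - (complex_of_real k)\<^sup>2)"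

definition r' where "r' w = inverse (w * (w\<^sup>2 - (complex_of_real k)\<^sup>2))"

definition phase_t where "phase_t w = \<i> * nu A B k w"

lemma holo [simp]: "h1 k holomorphic_on S" "h2 k holomorphic_on S" "nu A B k holomorphic_on S"
  "r holomorphic_on S" "r' holomorphic_on S"
  unfolding h1_def[abs_def] h2_def[abs_def] nu_def[abs_def] r_def[abs_def] r'_def[abs_def]
  using S_nonzero by (auto intro!: holomorphic_intros)

sublocale exponential_jets "(*) \<i>" phase_t S "of_real c"
proof
  show "open S"
    unfolding S_def by (intro open_Compl finite_imp_closed) simp
qed (auto intro!: holomorphic_intros c_in_S simp: phase_t_def[abs_def])

text \<open>As V1 = i k U1, this is the x-equation of the first lower component. It holds for every
  \<open>w\<close> in \<open>S\<close>, without the cubic, so the spatial defect is confined to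
  psi.\<close>

lemma ident_h1: "w \<in> S \<Longrightarrow> w * h1 k w = of_real k - of_real k * h1 k w"
  using S_nonzero[of w] by (simp add: h1_def divide_simps) (simp add: algebra_simps)

lemma ident_h2: "w \<in> S \<Longrightarrow> w * h2 k w = of_real k * h2 k w - of_real k"
  using S_nonzero[of w] by (simp add: h2_def divide_simps) (simp add: algebra_simps)

lemma nu_times_ident:
  "w \<in> S \<Longrightarrow> 2 * nu A B k w * w
    = (of_real A + of_real B) * w + 2 - of_real k * (of_real A - of_real B)"
  using S_nonzero[of w] by (simp add: nu_def field_simps)

text \<open>The t-equation of the first lower component before nu is eliminated; the term with
  \<open>omega1\<close> accounts for the t-derivative of U1. After clearing the denominators 0 and
  -k only the dispersion relation for \<open>omega1\<close> remains.\<close>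

lemma nu_h1:
  assumes "w \<in> S"
  shows "nu A B k w * h1 k w
    = nu A B k w - (of_real A + of_real B) / 2 - of_real (omega1 A k) * h1 k w"
proof -
  have h1: "h1 k w * (of_real k + w) = of_real k"
    and omega1: "of_real k * of_real (omega1 A k) = 1 - of_real k * complex_of_real A"
    using S_nonzero[OF assms] k by (simp_all add: h1_def omega1_def field_simps)
  have "(2 * nu A B k w * h1 k w - (2 * nu A B k w - (of_real A + of_real B)
      - 2 * of_real (omega1 A k) * h1 k w)) * (w * (of_real k + w))
    = (2 * nu A B k w * w) * (h1 k w * (of_real k + w)) - (2 * nu A B k w * w) * (of_real k + w)
      + (of_real A + of_real B) * (w * (of_real k + w))
      + 2 * of_real (omega1 A k) * w * (h1 k w * (of_real k + w))"
    by (simp add: algebra_simps)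
  also have "\<dots> = 2 * w * (of_real k * of_real (omega1 A k) - 1 + of_real k * of_real A)"
    unfolding h1 nu_times_ident[OF assms] by (simp add: algebra_simps)
  also have "\<dots> = 0"
    unfolding omega1 by simp
  finally have "2 * nu A B k w * h1 k w - (2 * nu A B k w - (of_real A + of_real B)
      - 2 * of_real (omega1 A k) * h1 k w) = 0"
    using S_nonzero[OF assms] by (simp only: mult_eq_0_iff) blast
  then show ?thesis
    by (rule half_identity)
qed

lemma nu_h2:
  assumes "w \<in> S"
  shows "nu A B k w * h2 k w
    = nu A B k w - (of_real A + of_real B) / 2 - of_real (omega2 B k) * h2 k w"
proof -
  have h2: "h2 k w * (of_real k - w) = of_real k"
    and omega2: "of_real k * of_real (omega2 B k) = - 1 - of_real k * complex_of_real B"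
    using S_nonzero[OF assms] k by (simp_all add: h2_def omega2_def field_simps)
  have "(2 * nu A B k w * h2 k w - (2 * nu A B k w - (of_real A + of_real B)
      - 2 * of_real (omega2 B k) * h2 k w)) * (w * (of_real k - w))
    = (2 * nu A B k w * w) * (h2 k w * (of_real k - w)) - (2 * nu A B k w * w) * (of_real k - w)
      + (of_real A + of_real B) * (w * (of_real k - w))
      + 2 * of_real (omega2 B k) * w * (h2 k w * (of_real k - w))"
    by (simp add: algebra_simps)
  also have "\<dots> = 2 * w * (of_real k * of_real (omega2 B k) + 1 + of_real k * of_real B)"
    unfolding h2 nu_times_ident[OF assms] by (simp add: algebra_simps)
  also have "\<dots> = 0"
    unfolding omega2 by simp
  finally have "2 * nu A B k w * h2 k w - (2 * nu A B k w - (of_real A + of_real B)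
      - 2 * of_real (omega2 B k) * h2 k w) = 0"
    using S_nonzero[OF assms] by (simp only: mult_eq_0_iff) blast
  then show ?thesis
    by (rule half_identity)
qed

text \<open>The psi-equation in x. Over the common denominator w^2 - k^2 its discrepancy is F(w;
  l^2), which the triple-root hypothesis replaces by l^2 (w - c)^3.\<close>

lemma spectral_x:
  assumes "w \<in> S"
  shows "of_real (l\<^sup>2) * w = 2 - of_real (k * A) * h1 k w + of_real (k * B) * h2 k w
    + of_real (l\<^sup>2) * ((w - of_real c) ^ 3 * r w)"
proof -
  let ?k = "complex_of_real k" and ?Q = "w\<^sup>2 - (complex_of_real k)\<^sup>2"
  have Q: "?Q * r w = 1" and h1: "h1 k w * ?Q = ?k * (w - ?k)" and h2: "h2 k w * ?Q = - ?k * (w + ?k)"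
    using S_nonzero[OF assms]
    by (simp_all add: r_def h1_def h2_def divide_simps) (simp_all add: algebra_simps power2_eq_square)
  have "of_real (l\<^sup>2) * w ^ 3 - 2 * w ^ 2 + ?k\<^sup>2 * (of_real A + of_real B - of_real (l\<^sup>2)) * w
      + ?k\<^sup>2 * (2 - ?k * (of_real A - of_real B)) = of_real (l\<^sup>2) * (w - of_real c) ^ 3"
    using cubic[of w] by (simp add: spatial_cubic_def)
  then have "(of_real (l\<^sup>2) * w - (2 - of_real (k * A) * h1 k w + of_real (k * B) * h2 k w)) * ?Q
      = of_real (l\<^sup>2) * (w - of_real c) ^ 3"
    using h1 h2 unfolding of_real_mult of_real_add by algebra
  then show ?thesis
    using Q by algebra
qed

text \<open>The psi-equation in t. \<open>nu\<close> adds a pole at 0, so the denominator is w (w^2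
  - k^2), and the discrepancy is now -F.\<close>

lemma spectral_t:
  assumes "w \<in> S"
  shows "2 * nu A B k w = of_real (A + B + l\<^sup>2) - of_real A * h1 k w - of_real B * h2 k w
    - of_real (l\<^sup>2) * ((w - of_real c) ^ 3 * r' w)"
proof -
  let ?k = "complex_of_real k" and ?Q = "w\<^sup>2 - (complex_of_real k)\<^sup>2"
  have Q: "w * ?Q * r' w = 1" and h1: "h1 k w * ?Q = ?k * (w - ?k)" and h2: "h2 k w * ?Q = - ?k * (w + ?k)"
    using S_nonzero[OF assms]
    by (simp_all add: r'_def h1_def h2_def divide_simps) (simp_all add: algebra_simps power2_eq_square)
  note nu = nu_times_ident[OF assms]
  have "of_real (l\<^sup>2) * w ^ 3 - 2 * w ^ 2 + ?k\<^sup>2 * (of_real A + of_real B - of_real (l\<^sup>2)) * w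
      + ?k\<^sup>2 * (2 - ?k * (of_real A - of_real B)) = of_real (l\<^sup>2) * (w - of_real c) ^ 3"
    using cubic[of w] by (simp add: spatial_cubic_def)
  then have "(2 * nu A B k w - (of_real (A + B + l\<^sup>2) - of_real A * h1 k w - of_real B * h2 k w)) * (w * ?Q)
      = - of_real (l\<^sup>2) * (w - of_real c) ^ 3"
    using h1 h2 nu unfolding of_real_mult of_real_add by algebra
  then show ?thesis
    using Q by algebra
qed

section \<open>The spectral identities under jet functionals\<close>

lemma comb_spectral_x:
  "of_real (l\<^sup>2) * jet_comb d q (\<lambda>w. w) x t = 2 * jet_comb d q (\<lambda>w. 1) x t
    - of_real (k * A) * jet_comb d q (h1 k) x t + of_real (k * B) * jet_comb d q (h2 k) x t
    + of_real (l\<^sup>2) * jet_comb d q (\<lambda>w. (w - of_real c) ^ 3 * r w) x t"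
proof -
  have "of_real (l\<^sup>2) * jet_comb d q (\<lambda>w. w) x t = jet_comb d q (\<lambda>w. of_real (l\<^sup>2) * w) x t"
    by (simp add: jet_comb_cmult holomorphic_intros)
  also have "\<dots> = jet_comb d q (\<lambda>w. (2 * 1 - of_real (k * A) * h1 k w + of_real (k * B) * h2 k w)
      + of_real (l\<^sup>2) * ((w - of_real c) ^ 3 * r w)) x t"
    by (rule jet_comb_cong) (simp_all add: spectral_x holomorphic_intros del: of_real_power of_real_mult)
  also have "\<dots> = 2 * jet_comb d q (\<lambda>w. 1) x t
    - of_real (k * A) * jet_comb d q (h1 k) x t + of_real (k * B) * jet_comb d q (h2 k) x t
    + of_real (l\<^sup>2) * jet_comb d q (\<lambda>w. (w - of_real c) ^ 3 * r w) x t"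
    by (simp only: jet_comb_add jet_comb_diff jet_comb_cmult holomorphic_intros holo)
  finally show ?thesis .
qed

lemma comb_spectral_t:
  "2 * jet_comb d q (nu A B k) x t = of_real (A + B + l\<^sup>2) * jet_comb d q (\<lambda>w. 1) x t
    - of_real A * jet_comb d q (h1 k) x t - of_real B * jet_comb d q (h2 k) x t
    - of_real (l\<^sup>2) * jet_comb d q (\<lambda>w. (w - of_real c) ^ 3 * r' w) x t"
proof -
  have "2 * jet_comb d q (nu A B k) x t = jet_comb d q (\<lambda>w. 2 * nu A B k w) x t"
    by (simp add: jet_comb_cmult holomorphic_intros)
  also have "\<dots> = jet_comb d q (\<lambda>w. (of_real (A + B + l\<^sup>2) * 1 - of_real A * h1 k w - of_real B * h2 k w)
      - of_real (l\<^sup>2) * ((w - of_real c) ^ 3 * r' w)) x t"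
    by (rule jet_comb_cong) (simp_all add: spectral_t holomorphic_intros del: of_real_power of_real_add)
  also have "\<dots> = of_real (A + B + l\<^sup>2) * jet_comb d q (\<lambda>w. 1) x t
    - of_real A * jet_comb d q (h1 k) x t - of_real B * jet_comb d q (h2 k) x t
    - of_real (l\<^sup>2) * jet_comb d q (\<lambda>w. (w - of_real c) ^ 3 * r' w) x t"
    by (simp only: jet_comb_add jet_comb_diff jet_comb_cmult holomorphic_intros holo)
  finally show ?thesis .
qed

lemma comb_ident_h1: "jet_comb d q (\<lambda>w. w * h1 k w) x t
    = of_real k * jet_comb d q (\<lambda>w. 1) x t - of_real k * jet_comb d q (h1 k) x t"
proof -
  have "jet_comb d q (\<lambda>w. w * h1 k w) x t
      = jet_comb d q (\<lambda>w. of_real k * 1 - of_real k * h1 k w) x t"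
    by (rule jet_comb_cong) (simp_all add: ident_h1 holomorphic_intros)
  then show ?thesis
    by (simp only: jet_comb_diff jet_comb_cmult holomorphic_intros holo)
qed

lemma comb_ident_h2: "jet_comb d q (\<lambda>w. w * h2 k w) x t
    = of_real k * jet_comb d q (h2 k) x t - of_real k * jet_comb d q (\<lambda>w. 1) x t"
proof -
  have "jet_comb d q (\<lambda>w. w * h2 k w) x t
      = jet_comb d q (\<lambda>w. of_real k * h2 k w - of_real k * 1) x t"
    by (rule jet_comb_cong) (simp_all add: ident_h2 holomorphic_intros)
  then show ?thesis
    by (simp only: jet_comb_diff jet_comb_cmult holomorphic_intros holo)
qed

lemma comb_nu_h1: "jet_comb d q (\<lambda>w. nu A B k w * h1 k w) x t
    = jet_comb d q (nu A B k) x t - (of_real A + of_real B) / 2 * jet_comb d q (\<lambda>w. 1) x t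
      - of_real (omega1 A k) * jet_comb d q (h1 k) x t"
proof -
  have "jet_comb d q (\<lambda>w. nu A B k w * h1 k w) x t
      = jet_comb d q (\<lambda>w. nu A B k w - (of_real A + of_real B) / 2 * 1
          - of_real (omega1 A k) * h1 k w) x t"
    by (rule jet_comb_cong) (simp_all add: nu_h1 holomorphic_intros)
  then show ?thesis
    by (simp only: jet_comb_diff jet_comb_cmult holomorphic_intros holo)
qed

lemma comb_nu_h2: "jet_comb d q (\<lambda>w. nu A B k w * h2 k w) x t
    = jet_comb d q (nu A B k) x t - (of_real A + of_real B) / 2 * jet_comb d q (\<lambda>w. 1) x t
      - of_real (omega2 B k) * jet_comb d q (h2 k) x t"
proof -
  have "jet_comb d q (\<lambda>w. nu A B k w * h2 k w) x t
      = jet_comb d q (\<lambda>w. nu A B k w - (of_real A + of_real B) / 2 * 1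
          - of_real (omega2 B k) * h2 k w) x t"
    by (rule jet_comb_cong) (simp_all add: nu_h2 holomorphic_intros)
  then show ?thesis
    by (simp only: jet_comb_diff jet_comb_cmult holomorphic_intros holo)
qed

end

section \<open>Jets of the plane-wave eigenfunction\<close>

context triple_root
begin

definition U1 where "U1 = u10 A k a1"
definition U2 where "U2 = u20 B k a2"
definition V1 where "V1 x t = \<i> * of_real k * U1 x t"
definition V2 where "V2 x t = - \<i> * of_real k * U2 x t"

lemma cnj_U: "cnj (U1 x t) * U1 x t = of_real A" "cnj (U2 x t) * U2 x t = of_real B"
proof -
  have "cnj (of_real b * exp (\<i> * of_real y)) * (of_real b * exp (\<i> * of_real y)) = of_real (b\<^sup>2)" for b y
    by (simp add: exp_cnj power2_eq_square mult_ac flip: exp_add)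
  then show "cnj (U1 x t) * U1 x t = of_real A" "cnj (U2 x t) * U2 x t = of_real B"
    using a by (simp_all only: U1_def U2_def u10_def u20_def)
qed

lemma U_x: "((\<lambda>s. U1 s t) has_vector_derivative V1 x t) (at x)"
  "((\<lambda>s. U2 s t) has_vector_derivative V2 x t) (at x)"
  unfolding U1_def U2_def u10_def u20_def V1_def V2_def
  by (auto intro!: derivative_eq_intros has_vector_derivative_exp_complex has_vector_derivative_of_real
      simp: algebra_simps)

lemma U_t: "((\<lambda>s. U1 x s) has_vector_derivative \<i> * of_real (omega1 A k) * U1 x t) (at t)"
  "((\<lambda>s. U2 x s) has_vector_derivative \<i> * of_real (omega2 B k) * U2 x t) (at t)"
  unfolding U1_def U2_def u10_def u20_def
  by (auto intro!: derivative_eq_intros has_vector_derivative_exp_complex has_vector_derivative_of_real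
      simp: algebra_simps)

lemma N_background: "U1 x t * cnj (U1 x t) + U2 x t * cnj (U2 x t) = of_real A + of_real B"
  using cnj_U[of x t] by (simp add: mult.commute)

lemma d_background: "cnj (U1 x t) * V1 x t + cnj (U2 x t) * V2 x t = \<i> * of_real k * (of_real A - of_real B)"
proof -
  have "cnj (U1 x t) * V1 x t + cnj (U2 x t) * V2 x t
      = \<i> * of_real k * (cnj (U1 x t) * U1 x t - cnj (U2 x t) * U2 x t)"
    by (simp add: V1_def V2_def algebra_simps)
  then show ?thesis
    by (simp add: cnj_U)
qed

lemma V_t: "((\<lambda>s. V1 x s) has_vector_derivative
    - U1 x t - \<i> / 2 * (U1 x t * cnj (U1 x t) + U2 x t * cnj (U2 x t)) * V1 x t
    - \<i> / 2 * (cnj (U1 x t) * V1 x t + cnj (U2 x t) * V2 x t) * U1 x t) (at t)"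
  "((\<lambda>s. V2 x s) has_vector_derivative
    - U2 x t - \<i> / 2 * (U1 x t * cnj (U1 x t) + U2 x t * cnj (U2 x t)) * V2 x t
    - \<i> / 2 * (cnj (U1 x t) * V1 x t + cnj (U2 x t) * V2 x t) * U2 x t) (at t)"
proof -
  have w: "complex_of_real k * of_real (omega1 A k) = 1 - of_real k * of_real A"
    "complex_of_real k * of_real (omega2 B k) = - 1 - of_real k * of_real B"
    using k by (simp_all add: omega1_def omega2_def field_simps)
  have "((\<lambda>s. V1 x s) has_vector_derivative \<i> * of_real k * (\<i> * of_real (omega1 A k) * U1 x t)) (at t)"
    unfolding V1_def by (intro has_vector_derivative_mult_right U_t)
  moreover have "\<i> * of_real k * (\<i> * of_real (omega1 A k) * U1 x t)
      = - (of_real k * of_real (omega1 A k)) * U1 x t"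
    by (simp add: mult_ac)
  ultimately have "((\<lambda>s. V1 x s) has_vector_derivative - (1 - of_real k * of_real A) * U1 x t) (at t)"
    unfolding w by simp
  then show "((\<lambda>s. V1 x s) has_vector_derivative
    - U1 x t - \<i> / 2 * (U1 x t * cnj (U1 x t) + U2 x t * cnj (U2 x t)) * V1 x t
    - \<i> / 2 * (cnj (U1 x t) * V1 x t + cnj (U2 x t) * V2 x t) * U1 x t) (at t)"
    unfolding N_background d_background w
    by (elim has_vector_derivative_eq_rhs)
      (simp add: V1_def algebra_simps add_divide_distrib diff_divide_distrib)
  have "((\<lambda>s. V2 x s) has_vector_derivative - \<i> * of_real k * (\<i> * of_real (omega2 B k) * U2 x t)) (at t)"
    unfolding V2_def by (intro has_vector_derivative_mult_right U_t)
  moreover have "- \<i> * of_real k * (\<i> * of_real (omega2 B k) * U2 x t)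
      = (of_real k * of_real (omega2 B k)) * U2 x t"
    by (simp add: mult_ac)
  ultimately have "((\<lambda>s. V2 x s) has_vector_derivative (- 1 - of_real k * of_real B) * U2 x t) (at t)"
    unfolding w by simp
  then show "((\<lambda>s. V2 x s) has_vector_derivative
    - U2 x t - \<i> / 2 * (U1 x t * cnj (U1 x t) + U2 x t * cnj (U2 x t)) * V2 x t
    - \<i> / 2 * (cnj (U1 x t) * V1 x t + cnj (U2 x t) * V2 x t) * U2 x t) (at t)"
    unfolding N_background d_background w
    by (elim has_vector_derivative_eq_rhs)
      (simp add: V2_def algebra_simps add_divide_distrib diff_divide_distrib)
qed

definition psi where "psi d q x t = of_real l * jet_comb d q (\<lambda>w. 1) x t"
definition phi1 where "phi1 d q x t = U1 x t * jet_comb d q (h1 k) x t"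
definition phi2 where "phi2 d q x t = U2 x t * jet_comb d q (h2 k) x t"
text \<open>The amounts by which a jet combination fails to solve the Lax pair.\<close>

definition defect_x where "defect_x d q = jet_comb d q (\<lambda>w. (w - of_real c) ^ 3 * r w)"
definition defect_t where "defect_t d q = jet_comb d q (\<lambda>w. (w - of_real c) ^ 3 * r' w)"

lemma comb_x: "g holomorphic_on S \<Longrightarrow> ((\<lambda>s. jet_comb d q g s t) has_vector_derivative
    \<i> * jet_comb d q (\<lambda>w. w * g w) x t) (at x)"
  using jet_comb_deriv_x[of g d q t x] by (simp add: mult.assoc jet_comb_cmult holomorphic_intros)

lemma comb_t: "g holomorphic_on S \<Longrightarrow> ((\<lambda>s. jet_comb d q g x s) has_vector_derivative
    \<i> * jet_comb d q (\<lambda>w. nu A B k w * g w) x t) (at t)"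
  using jet_comb_deriv_t[of g d q x t] by (simp add: phase_t_def mult.assoc jet_comb_cmult holomorphic_intros)

lemma VU: "cnj (V1 x t) * phi1 d q x t + cnj (V2 x t) * phi2 d q x t
    = - \<i> * (of_real (k * A) * jet_comb d q (h1 k) x t - of_real (k * B) * jet_comb d q (h2 k) x t)"
proof -
  have "cnj (V1 x t) * phi1 d q x t + cnj (V2 x t) * phi2 d q x t
      = - \<i> * of_real k * ((cnj (U1 x t) * U1 x t) * jet_comb d q (h1 k) x t
          - (cnj (U2 x t) * U2 x t) * jet_comb d q (h2 k) x t)"
    by (simp add: V1_def V2_def phi1_def phi2_def algebra_simps)
  then show ?thesis
    unfolding cnj_U by (simp add: algebra_simps)
qed

lemma lax_e_comb: "lax_e l (U1 x t) (U2 x t) (psi d q x t) (phi1 d q x t) (phi2 d q x t)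
    = of_real (l\<^sup>2) * jet_comb d q (\<lambda>w. 1) x t - of_real A * jet_comb d q (h1 k) x t
      - of_real B * jet_comb d q (h2 k) x t"
proof -
  have "lax_e l (U1 x t) (U2 x t) (psi d q x t) (phi1 d q x t) (phi2 d q x t)
    = of_real (l\<^sup>2) * jet_comb d q (\<lambda>w. 1) x t - (cnj (U1 x t) * U1 x t) * jet_comb d q (h1 k) x t
      - (cnj (U2 x t) * U2 x t) * jet_comb d q (h2 k) x t"
    by (simp add: lax_e_def psi_def phi1_def phi2_def algebra_simps power2_eq_square)
  then show ?thesis
    unfolding cnj_U .
qed

lemma psi_x: "((\<lambda>s. psi d q s t) has_vector_derivative
    ((cnj (V1 x t) * phi1 d q x t + cnj (V2 x t) * phi2 d q x t) / l + 2 * \<i> / (of_real l)\<^sup>2 * psi d q x t)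
    + \<i> * l * defect_x d q x t) (at x)"
  (is "(_ has_vector_derivative ?D) _")
proof -
  let ?w = "jet_comb d q (\<lambda>w. w) x t"
  have "((\<lambda>s. psi d q s t) has_vector_derivative l * (\<i> * ?w)) (at x)"
    unfolding psi_def using comb_x[of "\<lambda>w. 1" d q t x]
    by (intro has_vector_derivative_mult_right) simp
  moreover have "?D = \<i> / l * (2 * jet_comb d q (\<lambda>w. 1) x t
    - of_real (k * A) * jet_comb d q (h1 k) x t + of_real (k * B) * jet_comb d q (h2 k) x t
    + of_real (l\<^sup>2) * defect_x d q x t)"
    unfolding VU psi_def using l by (simp add: field_simps power2_eq_square)
  moreover have "\<dots> = l * (\<i> * ?w)"
    unfolding defect_x_def comb_spectral_x[symmetric] using l by (simp add: power2_eq_square)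
  ultimately show ?thesis
    by simp
qed

lemma phi1_x: "((\<lambda>s. phi1 d q s t) has_vector_derivative V1 x t * psi d q x t / l) (at x)"
  unfolding phi1_def
  by (rule has_vector_derivative_eq_rhs[OF has_vector_derivative_mult[OF U_x(1) comb_x]])
    (use l in \<open>simp_all add: comb_ident_h1 V1_def psi_def algebra_simps\<close>)

lemma phi2_x: "((\<lambda>s. phi2 d q s t) has_vector_derivative V2 x t * psi d q x t / l) (at x)"
  unfolding phi2_def
  by (rule has_vector_derivative_eq_rhs[OF has_vector_derivative_mult[OF U_x(2) comb_x]])
    (use l in \<open>simp_all add: comb_ident_h2 V2_def psi_def algebra_simps\<close>)

text \<open>\<open>spectral_t\<close> solved for nu in Lax variables. Since nu enters the
  t-derivative of all three components, the temporal defect reaches each of them, unlike the spatial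
  one.\<close>

lemma comb_nu: "jet_comb d q (nu A B k) x t = ((of_real A + of_real B) * jet_comb d q (\<lambda>w. 1) x t
    + lax_e l (U1 x t) (U2 x t) (psi d q x t) (phi1 d q x t) (phi2 d q x t)
    - of_real (l\<^sup>2) * defect_t d q x t) / 2"
  unfolding lax_e_comb defect_t_def using comb_spectral_t[of d q x t]
  by (simp add: algebra_simps)

lemma psi_t: "((\<lambda>s. psi d q x s) has_vector_derivative
    \<i> / 2 * ((U1 x t * cnj (U1 x t) + U2 x t * cnj (U2 x t)) * psi d q x t
      + l * lax_e l (U1 x t) (U2 x t) (psi d q x t) (phi1 d q x t) (phi2 d q x t))
    - \<i> * of_real l ^ 3 / 2 * defect_t d q x t) (at t)"
proof -
  have "((\<lambda>s. psi d q x s) has_vector_derivative l * (\<i> * jet_comb d q (nu A B k) x t)) (at t)"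
    unfolding psi_def using comb_t[of "\<lambda>w. 1" d q x t]
    by (intro has_vector_derivative_mult_right) simp
  then show ?thesis
    unfolding comb_nu N_background
    by (rule has_vector_derivative_eq_rhs)
      (simp add: psi_def algebra_simps power2_eq_square power3_eq_cube add_divide_distrib diff_divide_distrib)
qed

lemma phi1_t: "((\<lambda>s. phi1 d q x s) has_vector_derivative
    \<i> / 2 * lax_e l (U1 x t) (U2 x t) (psi d q x t) (phi1 d q x t) (phi2 d q x t) * U1 x t
    - \<i> * (of_real l)\<^sup>2 / 2 * U1 x t * defect_t d q x t) (at t)"
  unfolding phi1_def
  by (rule has_vector_derivative_eq_rhs[OF has_vector_derivative_mult[OF U_t(1) comb_t]])
    (unfold comb_nu_h1 comb_nu phi1_def,
      simp_all add: algebra_simps add_divide_distrib diff_divide_distrib)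

lemma phi2_t: "((\<lambda>s. phi2 d q x s) has_vector_derivative
    \<i> / 2 * lax_e l (U1 x t) (U2 x t) (psi d q x t) (phi1 d q x t) (phi2 d q x t) * U2 x t
    - \<i> * (of_real l)\<^sup>2 / 2 * U2 x t * defect_t d q x t) (at t)"
  unfolding phi2_def
  by (rule has_vector_derivative_eq_rhs[OF has_vector_derivative_mult[OF U_t(2) comb_t]])
    (unfold comb_nu_h2 comb_nu phi2_def,
      simp_all add: algebra_simps add_divide_distrib diff_divide_distrib)

end

section \<open>Defects and Gram entries of the jets at the triple root\<close>

context triple_root
begin

lemma jet_comb_3: "jet_comb 3 q g x t = q 0 * jet 0 g x t + q 1 * jet 1 g x t + q 2 * jet 2 g x t"
  by (simp add: jet_comb_def eval_nat_numeral)

text \<open>A functional of order below 3 kills every multiple of (w - c)^3: three shifts leave an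
  empty sum in \<open>jet_comb_cube\<close>.\<close>

lemma defect_3: "defect_x 3 q x t = 0" "defect_t 3 q x t = 0"
proof -
  have "jet_comb 3 q (\<lambda>w. (w - of_real c) ^ 3 * g w) x t = 0" if "g holomorphic_on S" for g
    using jet_comb_cube[OF that, of 0 q x t] by (simp add: numeral_3_eq_3 jet_comb_def)
  then show "defect_x 3 q x t = 0" "defect_t 3 q x t = 0"
    by (simp_all add: defect_x_def defect_t_def)
qed

definition dressing_coeffs :: "complex \<Rightarrow> complex \<Rightarrow> nat \<Rightarrow> complex" where
  "dressing_coeffs M1 M2 n = (if n = 0 then 1 else if n = 1 then M1 else if n = 2 then M2 / 2 else 0)"

definition chain_coeffs :: "complex \<Rightarrow> complex \<Rightarrow> nat \<Rightarrow> complex" where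
  "chain_coeffs M1 M2 n =
    (if n = 3 then calM3 k (of_real c) (of_real (l\<^sup>2)) M1 M2 / 6
     else if n = 4 then calM4 k (of_real c) (of_real (l\<^sup>2)) M1 M2 / 24
     else if n = 5 then calM5 k (of_real c) (of_real (l\<^sup>2)) M2 / 120 else 0)"

text \<open>The factor w^3 - k^2 w is the derivative of F in mu, and l^2 (w - c)^3 is F itself, so
  this is the compatibility N(F g) + L(F_mu g) = 0. Its Taylor coefficients at c are
  \<open>D0\<close>, \<open>D1\<close>, 3c and 1; L kills the cubic term.\<close>

lemma chain_defect:
  assumes g: "g holomorphic_on S"
  shows "of_real (l\<^sup>2) * jet_comb 6 (chain_coeffs M1 M2) (\<lambda>w. (w - of_real c) ^ 3 * g w) x t
    = - jet_comb 3 (dressing_coeffs M1 M2) (\<lambda>w. (w ^ 3 - of_real (k\<^sup>2) * w) * g w) x t"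
proof -
  let ?c = "complex_of_real c" and ?L = "jet_comb 3 (dressing_coeffs M1 M2)"
  let ?d = "\<lambda>g w. (w - ?c) * g w"
  have dg: "?d g holomorphic_on S" "?d (?d g) holomorphic_on S" "?d (?d (?d g)) holomorphic_on S"
    using g by (auto intro!: holomorphic_intros)
  have L1: "?L (?d g) x t = M1 * jet 0 g x t + M2 * jet 1 g x t"
    and L2: "?L (?d (?d g)) x t = M2 * jet 0 g x t" and L3: "?L (?d (?d (?d g))) x t = 0"
    using g dg by (simp_all add: numeral_3_eq_3 jet_comb_lower)
      (simp_all add: jet_comb_def dressing_coeffs_def eval_nat_numeral)
  have "?L (\<lambda>w. (w ^ 3 - of_real (k\<^sup>2) * w) * g w) x t
      = ?L (\<lambda>w. (D0 k ?c * g w + D1 k ?c * ?d g w) + (3 * ?c * ?d (?d g) w + ?d (?d (?d g)) w)) x t"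
  proof (rule jet_comb_cong)
    show "(\<lambda>w. (w ^ 3 - of_real (k\<^sup>2) * w) * g w) holomorphic_on S"
      using g by (auto intro!: holomorphic_intros)
    show "(w ^ 3 - of_real (k\<^sup>2) * w) * g w
        = (D0 k ?c * g w + D1 k ?c * ?d g w) + (3 * ?c * ?d (?d g) w + ?d (?d (?d g)) w)" for w
      by (simp add: D0_def D1_def algebra_simps power2_eq_square power3_eq_cube)
  qed
  also have "\<dots> = (D0 k ?c * ?L g x t + D1 k ?c * ?L (?d g) x t)
      + (3 * ?c * ?L (?d (?d g)) x t + ?L (?d (?d (?d g))) x t)"
    using g dg by (simp only: jet_comb_add jet_comb_cmult holomorphic_intros)
  finally have R: "?L (\<lambda>w. (w ^ 3 - of_real (k\<^sup>2) * w) * g w) x t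
      = (D0 k ?c + D1 k ?c * M1 + 3 * ?c * M2) * jet 0 g x t + (D0 k ?c * M1 + D1 k ?c * M2) * jet 1 g x t
        + D0 k ?c * M2 / 2 * jet 2 g x t"
    unfolding L1 L2 L3 by (simp add: jet_comb_3 dressing_coeffs_def algebra_simps)
  have six: "6 = Suc (Suc (Suc 3))"
    by simp
  \<comment> \<open>Three shifts produce the factors 6, 24 and 60; against the denominators 6, 24
    and 120 they leave the weights 1, 1 and 1/2 of the dressing functional.\<close>
  have J: "jet_comb 6 (chain_coeffs M1 M2) (\<lambda>w. (w - of_real c) ^ 3 * g w) x t
      = calM3 k ?c (of_real (l\<^sup>2)) M1 M2 * jet 0 g x t + calM4 k ?c (of_real (l\<^sup>2)) M1 M2 * jet 1 g x t
        + calM5 k ?c (of_real (l\<^sup>2)) M2 / 2 * jet 2 g x t"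
    unfolding six jet_comb_cube[OF g] jet_comb_3 by (simp add: chain_coeffs_def eval_nat_numeral)
  have cancel: "M * (- x / M * j0 + - y / M * j1 + - z / M / 2 * j2) = - (x * j0 + y * j1 + z / 2 * j2)"
    if "M \<noteq> 0" for M x y z j0 j1 j2 :: complex
    using that by (simp add: field_simps)
  have "complex_of_real (l\<^sup>2) \<noteq> 0"
    using l by simp
  from cancel[OF this] show ?thesis
    unfolding J R calM3_def calM4_def calM5_def by (simp only:) (simp add: algebra_simps)
qed

text \<open>Against the cofactor \<open>r\<close>, F_mu collapses to w, and against
  \<open>r'\<close> in the next lemma to 1. The chain defects are therefore known multiples of the
  x-derivative of psi_R and of psi_R itself.\<close>

lemma chain_defect_x: "of_real (l\<^sup>2) * defect_x 6 (chain_coeffs M1 M2) x t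
    = - jet_comb 3 (dressing_coeffs M1 M2) (\<lambda>w. w) x t"
proof -
  have "jet_comb 3 (dressing_coeffs M1 M2) (\<lambda>w. (w ^ 3 - of_real (k\<^sup>2) * w) * r w) x t
      = jet_comb 3 (dressing_coeffs M1 M2) (\<lambda>w. w) x t"
  proof (rule jet_comb_cong)
    show "(w ^ 3 - of_real (k\<^sup>2) * w) * r w = w" if "w \<in> S" for w
    proof -
      have "w ^ 3 - of_real (k\<^sup>2) * w = w * (w\<^sup>2 - (of_real k)\<^sup>2)"
        by (simp add: algebra_simps power2_eq_square power3_eq_cube)
      then show ?thesis
        by (simp only: r_def mult.assoc right_inverse[OF S_nonzero(4)[OF that]] mult_1_right)
    qed
  qed (auto intro!: holomorphic_intros)
  then show ?thesis
    unfolding defect_x_def using chain_defect[of r M1 M2 x t] by simp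
qed

lemma chain_defect_t: "of_real (l\<^sup>2) * defect_t 6 (chain_coeffs M1 M2) x t
    = - jet_comb 3 (dressing_coeffs M1 M2) (\<lambda>w. 1) x t"
proof -
  have "jet_comb 3 (dressing_coeffs M1 M2) (\<lambda>w. (w ^ 3 - of_real (k\<^sup>2) * w) * r' w) x t
      = jet_comb 3 (dressing_coeffs M1 M2) (\<lambda>w. 1) x t"
  proof (rule jet_comb_cong)
    show "(w ^ 3 - of_real (k\<^sup>2) * w) * r' w = 1" if "w \<in> S" for w
    proof -
      have "w ^ 3 - of_real (k\<^sup>2) * w = w * (w\<^sup>2 - (of_real k)\<^sup>2)"
        by (simp add: algebra_simps power2_eq_square power3_eq_cube)
      then show ?thesis
        using S_nonzero(1,4)[OF that] by (simp only: r'_def right_inverse mult_eq_0_iff simp_thms)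
    qed
  qed (auto intro!: holomorphic_intros)
  then show ?thesis
    unfolding defect_t_def using chain_defect[of r' M1 M2 x t] by simp
qed

definition jet_pairing :: "nat \<Rightarrow> nat \<Rightarrow> real \<Rightarrow> real \<Rightarrow> complex" where
  "jet_pairing i j x t = pairing (l * jet i (\<lambda>w. 1) x t) (U1 x t * jet i (h1 k) x t) (U2 x t * jet i (h2 k) x t)
     (l * jet j (\<lambda>w. 1) x t) (U1 x t * jet j (h1 k) x t) (U2 x t * jet j (h2 k) x t)"

text \<open>The Lax matrices are anti-Hermitian with respect to \<open>J\<close> for real \<open>\<lambda>\<close>.\<close>

lemma comb_pairing_const:
  "pairing (psi 3 p x t) (phi1 3 p x t) (phi2 3 p x t) (psi 3 q x t) (phi1 3 q x t) (phi2 3 q x t)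
    = pairing (psi 3 p 0 0) (phi1 3 p 0 0) (phi2 3 p 0 0) (psi 3 q 0 0) (phi1 3 q 0 0) (phi2 3 q 0 0)"
  (is "?F x t = ?F 0 0")
proof -
  have const: "f s = f 0" if "\<And>s. (f has_vector_derivative 0) (at s)" for f :: "real \<Rightarrow> complex" and s
    using has_vector_derivative_zero_constant[of UNIV f] that by (metis UNIV_I convex_UNIV)
  have dx: "((\<lambda>s. ?F s t) has_vector_derivative 0) (at x)" for x t
    by (rule has_vector_derivative_eq_rhs[OF has_vector_derivative_pairing[OF
            psi_x phi1_x phi2_x psi_x phi1_x phi2_x]])
      (simp only: defect_3 mult_zero_right add_0_right pairing_lax_x)
  have x: "?F x t = ?F 0 t" for x t
    by (rule const[of "\<lambda>s. ?F s t"]) (rule dx)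
  have N: "cnj (U1 x t * cnj (U1 x t) + U2 x t * cnj (U2 x t)) = U1 x t * cnj (U1 x t) + U2 x t * cnj (U2 x t)" for x t
    by (simp add: mult.commute)
  have dt: "((\<lambda>s. ?F x s) has_vector_derivative 0) (at t)" for x t
    by (rule has_vector_derivative_eq_rhs[OF has_vector_derivative_pairing[OF
            psi_t phi1_t phi2_t psi_t phi1_t phi2_t]])
      (simp only: defect_3 mult_zero_right diff_0_right pairing_lax_t[OF N])
  have y: "?F x t = ?F x 0" for x t
    by (rule const[of "\<lambda>s. ?F x s"]) (rule dt)
  show ?thesis
    by (rule trans[OF x[of x t] y[of 0 t]])
qed

lemma jet_pairing_const:
  assumes "i \<le> 2" "j \<le> 2"
  shows "jet_pairing i j x t = jet_pairing i j 0 0"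
proof -
  define unit :: "nat \<Rightarrow> nat \<Rightarrow> complex" where "unit i n = (if n = i then 1 else 0)" for i n
  have "jet_comb 3 (unit i) g x t = jet i g x t" if "i \<le> 2" for i g x t
    using that by (simp add: jet_comb_def unit_def if_distrib[of "\<lambda>c. c * _"] cong: if_cong)
  then have "jet_pairing i j x t = pairing (psi 3 (unit i) x t) (phi1 3 (unit i) x t) (phi2 3 (unit i) x t)
      (psi 3 (unit j) x t) (phi1 3 (unit j) x t) (phi2 3 (unit j) x t)" for x t
    using assms by (simp add: jet_pairing_def psi_def phi1_def phi2_def)
  then show ?thesis
    using comb_pairing_const by metis
qed

lemma jet_one_origin: "jet n (\<lambda>w. 1) 0 0 = (if n = 0 then 1 else 0)"
proof -
  have "wave (\<lambda>w. 1) 0 0 = (\<lambda>w. 1)"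
    by (simp add: wave_def fun_eq_iff)
  then show ?thesis
    by (simp add: jet_def)
qed

text \<open>\<open>ident_h1\<close> with w written as c + (w - c) gives a real recursion in n, so no
  quotient has to be differentiated repeatedly.\<close>

lemma jet_h1: "of_real (k + c) * jet n (h1 k) x t
    = of_real k * jet n (\<lambda>w. 1) x t - of_nat n * jet (n - 1) (h1 k) x t"
proof -
  have "of_nat n * jet (n - 1) (h1 k) x t = jet n (\<lambda>w. (w - of_real c) * h1 k w) x t"
    by (simp add: jet_lower)
  also have "\<dots> = jet n (\<lambda>w. of_real k * 1 + - of_real (k + c) * h1 k w) x t"
    by (rule jet_cong) (auto intro!: holomorphic_intros simp: algebra_simps ident_h1)
  also have "\<dots> = of_real k * jet n (\<lambda>w. 1) x t + - of_real (k + c) * jet n (h1 k) x t"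
    by (simp only: jet_add jet_cmult holomorphic_intros holo)
  finally show ?thesis
    by (simp add: algebra_simps)
qed

lemma jet_h2: "of_real (k - c) * jet n (h2 k) x t
    = of_real k * jet n (\<lambda>w. 1) x t + of_nat n * jet (n - 1) (h2 k) x t"
proof -
  have "of_nat n * jet (n - 1) (h2 k) x t = jet n (\<lambda>w. (w - of_real c) * h2 k w) x t"
    by (simp add: jet_lower)
  also have "\<dots> = jet n (\<lambda>w. - of_real k * 1 + of_real (k - c) * h2 k w) x t"
    by (rule jet_cong) (auto intro!: holomorphic_intros simp: algebra_simps ident_h2)
  also have "\<dots> = - of_real k * jet n (\<lambda>w. 1) x t + of_real (k - c) * jet n (h2 k) x t"
    by (simp only: jet_add jet_cmult holomorphic_intros holo)
  finally show ?thesis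
    by (simp add: algebra_simps)
qed

lemma kc_nonzero: "k + c \<noteq> 0" "k - c \<noteq> 0"
  using c by auto

lemma jet_h_origin_real: "jet n (h1 k) 0 0 \<in> \<real>" "jet n (h2 k) 0 0 \<in> \<real>"
proof -
  have h: "jet n (h1 k) 0 0 = (of_real k * jet n (\<lambda>w. 1) 0 0 - of_nat n * jet (n - 1) (h1 k) 0 0) / of_real (k + c)"
    "jet n (h2 k) 0 0 = (of_real k * jet n (\<lambda>w. 1) 0 0 + of_nat n * jet (n - 1) (h2 k) 0 0) / of_real (k - c)" for n
    using kc_nonzero unfolding jet_h1[symmetric] jet_h2[symmetric] by (simp_all del: of_real_add of_real_diff)
  show "jet n (h1 k) 0 0 \<in> \<real>"
  proof (induction n)
    case (Suc n)
    then show ?case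
      unfolding h(1)[of "Suc n"] jet_one_origin by auto
  qed (subst h(1), auto simp: jet_one_origin)
  show "jet n (h2 k) 0 0 \<in> \<real>"
  proof (induction n)
    case (Suc n)
    then show ?case
      unfolding h(2)[of "Suc n"] jet_one_origin by auto
  qed (subst h(2), auto simp: jet_one_origin)
qed

lemma U_origin: "U1 0 0 = of_real a1" "U2 0 0 = of_real a2"
  by (simp_all add: U1_def U2_def u10_def u20_def)

lemma jet_pairing_origin_real: "jet_pairing i j 0 0 \<in> \<real>"
proof -
  have "cnj (jet n (h1 k) 0 0) = jet n (h1 k) 0 0" "cnj (jet n (h2 k) 0 0) = jet n (h2 k) 0 0" for n
    using jet_h_origin_real[of n] by (simp_all add: Reals_cnj_iff)
  then show ?thesis
    unfolding jet_pairing_def pairing_def jet_one_origin U_origin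
    using jet_h_origin_real by (auto intro!: Reals_diff Reals_mult)
qed

text \<open>These entries are the ones missing from the null constraint. At the origin g00 and 2 g01
  are the first and second derivatives at c of l^2 w - 2 + kA h1 - kB h2, which has a triple zero by
  \<open>spectral_x\<close>. The proof verifies the vanishing with the closed forms of A and
  B.\<close>

lemma jet_pairing_0: "jet_pairing 0 0 x t = 0" "jet_pairing 0 1 x t = 0"
proof -
  define p q where "p = k / (k + c)" and "q = k / (k - c)"
  have h0: "jet 0 (h1 k) 0 0 = of_real p" "jet 0 (h2 k) 0 0 = of_real q"
    using kc_nonzero by (simp_all add: jet_0 h1_def h2_def p_def q_def)
  \<comment> \<open>Written with the factor k + c so that \<open>jet_h1\<close> can rewrite the
    numerator.\<close>
  have "jet 1 (h1 k) 0 0 = of_real (k + c) * jet 1 (h1 k) 0 0 / of_real (k + c)"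
    "jet 1 (h2 k) 0 0 = of_real (k - c) * jet 1 (h2 k) 0 0 / of_real (k - c)"
    using kc_nonzero by (simp_all del: of_real_add of_real_diff)
  then have h1: "jet 1 (h1 k) 0 0 = of_real (- p / (k + c))" "jet 1 (h2 k) 0 0 = of_real (q / (k - c))"
    unfolding jet_h1 jet_h2 by (simp_all add: jet_one_origin h0)
  have "A * p\<^sup>2 = (k + c) / (3 * c * k)" "B * q\<^sup>2 = (k - c) / (3 * c * k)"
    unfolding A B p_def q_def using kc_nonzero k c
    by (simp_all add: divide_simps) (simp_all add: power2_eq_square power3_eq_cube)
  moreover have "(k + c) / (3 * c * k) + (k - c) / (3 * c * k) = 2 / (3 * c)"
    using k c by (simp add: field_simps)
  ultimately have "l\<^sup>2 - A * p\<^sup>2 - B * q\<^sup>2 = 0"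
    by (simp add: l2)
  moreover have "jet_pairing 0 0 0 0 = of_real (l\<^sup>2 - a1\<^sup>2 * p\<^sup>2 - a2\<^sup>2 * q\<^sup>2)"
    by (simp add: jet_pairing_def pairing_def jet_one_origin U_origin h0 power2_eq_square mult_ac)
  ultimately have "jet_pairing 0 0 0 0 = 0"
    by (simp only: a of_real_0)
  then show "jet_pairing 0 0 x t = 0"
    using jet_pairing_const[of 0 0 x t] by simp
  have "A * p * (p / (k + c)) = 1 / (3 * c * k)" "B * q * (q / (k - c)) = 1 / (3 * c * k)"
    unfolding A B p_def q_def using kc_nonzero k c
    by (simp_all add: divide_simps) (simp_all add: power2_eq_square power3_eq_cube)
  then have "A * p * (p / (k + c)) - B * q * (q / (k - c)) = 0"
    by simp
  moreover have "jet_pairing 0 1 0 0 = of_real (a1\<^sup>2 * p * (p / (k + c)) - a2\<^sup>2 * q * (q / (k - c)))"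
    using h1 by (simp add: jet_pairing_def pairing_def jet_one_origin U_origin h0 power2_eq_square mult_ac)
  ultimately have "jet_pairing 0 1 0 0 = 0"
    by (simp only: a of_real_0)
  then show "jet_pairing 0 1 x t = 0"
    using jet_pairing_const[of 0 1 x t] by simp
qed

end

section \<open>Assembling the rational solution\<close>

lemma braket_J: "braket f J_mat g = pairing (f $ 1) (f $ 2) (f $ 3) (g $ 1) (g $ 2) (g $ 3)"
  by (simp add: braket_def J_mat_def pairing_def matrix_vector_mult_def sum_3)

lemma braket_K: "braket f K_mat g = hermitian_dot f g"
  by (simp add: braket_def K_mat_def hermitian_dot_def)

lemma cnj_pairing: "cnj (pairing q g1 g2 p f1 f2) = pairing p f1 f2 q g1 g2"
  by (simp add: pairing_def mult.commute)

lemma pairing_comb3: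
  fixes s1 s2 x0 x1 x2 y0 y1 y2 z0 z1 z2 :: complex
  shows "pairing (x0 + s1 * x1 + s2 * x2) (y0 + s1 * y1 + s2 * y2) (z0 + s1 * z1 + s2 * z2)
      (x0 + s1 * x1 + s2 * x2) (y0 + s1 * y1 + s2 * y2) (z0 + s1 * z1 + s2 * z2)
    = pairing x0 y0 z0 x0 y0 z0 + s1 * pairing x0 y0 z0 x1 y1 z1 + s2 * pairing x0 y0 z0 x2 y2 z2
      + cnj s1 * (pairing x1 y1 z1 x0 y0 z0 + s1 * pairing x1 y1 z1 x1 y1 z1 + s2 * pairing x1 y1 z1 x2 y2 z2)
      + cnj s2 * (pairing x2 y2 z2 x0 y0 z0 + s1 * pairing x2 y2 z2 x1 y1 z1 + s2 * pairing x2 y2 z2 x2 y2 z2)"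
  by (simp add: pairing_def algebra_simps)

context triple_root
begin

lemma wave_E: "wave (\<lambda>w. 1) x t = E_fun A B k x t"
  by (simp add: fun_eq_iff wave_def E_fun_def phase_t_def algebra_simps)

lemma E_der_jet: "E_der A B k (of_real c) n x t = jet n (\<lambda>w. 1) x t"
  by (simp add: E_der_def jet_def wave_E)

lemma Y_vec_jet:
  "Y_vec A B k a1 a2 (of_real c) l n x t $ 1 = l * jet n (\<lambda>w. 1) x t"
  "Y_vec A B k a1 a2 (of_real c) l n x t $ 2 = U1 x t * jet n (h1 k) x t"
  "Y_vec A B k a1 a2 (of_real c) l n x t $ 3 = U2 x t * jet n (h2 k) x t"
proof -
  have wave: "wave g x t = (\<lambda>w. g w * E_fun A B k x t w)" for g
    unfolding wave_E[symmetric] by (simp add: wave_def fun_eq_iff)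
  have cmult: "(deriv ^^ n) (\<lambda>w. b * (g w * E_fun A B k x t w)) (of_real c) = b * jet n g x t"
    if "g holomorphic_on S" for b g
    using higher_deriv_cmult[OF holo_wave[OF that] z_in_S open_S, of n b x t]
    by (simp add: jet_def wave)
  show "Y_vec A B k a1 a2 (of_real c) l n x t $ 1 = l * jet n (\<lambda>w. 1) x t"
    using cmult[of "\<lambda>w. 1" "of_real l"] by (simp add: Y_vec_def y_vec_def)
  show "Y_vec A B k a1 a2 (of_real c) l n x t $ 2 = U1 x t * jet n (h1 k) x t"
    using cmult[of "h1 k" "U1 x t"] by (simp add: Y_vec_def y_vec_def U1_def mult.assoc)
  show "Y_vec A B k a1 a2 (of_real c) l n x t $ 3 = U2 x t * jet n (h2 k) x t"
    using cmult[of "h2 k" "U2 x t"] by (simp add: Y_vec_def y_vec_def U2_def mult.assoc)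
qed

lemma braket_Y: "braket (Y_vec A B k a1 a2 (of_real c) l i x t) J_mat (Y_vec A B k a1 a2 (of_real c) l j x t)
    = jet_pairing i j x t"
  by (simp add: braket_J Y_vec_jet jet_pairing_def)

lemma jet_pairing_gram:
  assumes "i \<le> 2" "j \<le> 2"
  shows "jet_pairing i j x t = of_real (gram A B k a1 a2 (of_real c) l i j)"
  unfolding gram_def braket_Y jet_pairing_const[OF assms, of x t]
  using jet_pairing_origin_real[of i j] by simp

end

locale triple_root_dressing = triple_root +
  fixes M1 M2 zeta :: complex
  assumes zeta: "zeta \<notin> \<real>"
    and null_constraint: "gram A B k a1 a2 (of_real c) l 1 1 * (cmod M1)\<^sup>2
      + gram A B k a1 a2 (of_real c) l 0 2 * Re M2
      + Re (complex_of_real (gram A B k a1 a2 (of_real c) l 1 2) * cnj M1 * M2)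
      + gram A B k a1 a2 (of_real c) l 2 2 / 4 * (cmod M2)\<^sup>2 = 0"
begin

abbreviation L where "L \<equiv> jet_comb 3 (dressing_coeffs M1 M2)"

definition P where "P = psi 3 (dressing_coeffs M1 M2)"
definition F1 where "F1 = phi1 3 (dressing_coeffs M1 M2)"
definition F2 where "F2 = phi2 3 (dressing_coeffs M1 M2)"
text \<open>Only the first component lambda E depends explicitly on lambda. Its derivative in mu is
  E/(2 lambda), that is lambda E/(2 lambda^2), hence the multiple of \<open>P\<close>.\<close>

definition Q where "Q x t = psi 6 (chain_coeffs M1 M2) x t + 1 / (2 * of_real l ^ 2) * P x t"
definition G1 where "G1 = phi1 6 (chain_coeffs M1 M2)"
definition G2 where "G2 = phi2 6 (chain_coeffs M1 M2)"

lemma L_jets: "L g x t = jet 0 g x t + M1 * jet 1 g x t + M2 / 2 * jet 2 g x t"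
  by (simp add: jet_comb_3 dressing_coeffs_def)

lemma yR_components:
  "yR_vec A B k a1 a2 (of_real c) l M1 M2 x t $ 1 = P x t"
  "yR_vec A B k a1 a2 (of_real c) l M1 M2 x t $ 2 = F1 x t"
  "yR_vec A B k a1 a2 (of_real c) l M1 M2 x t $ 3 = F2 x t"
  by (simp_all add: yR_vec_def Y_vec_jet P_def F1_def F2_def psi_def phi1_def phi2_def L_jets algebra_simps)

lemma ymu_components:
  "ymu_vec A B k a1 a2 (of_real c) (of_real (l\<^sup>2)) l M1 M2 x t $ 1 = Q x t"
  "ymu_vec A B k a1 a2 (of_real c) (of_real (l\<^sup>2)) l M1 M2 x t $ 2 = G1 x t"
  "ymu_vec A B k a1 a2 (of_real c) (of_real (l\<^sup>2)) l M1 M2 x t $ 3 = G2 x t"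
proof -
  have N: "jet_comb 6 (chain_coeffs M1 M2) g x t
      = calM3 k (of_real c) (of_real (l\<^sup>2)) M1 M2 / 6 * jet 3 g x t
      + calM4 k (of_real c) (of_real (l\<^sup>2)) M1 M2 / 24 * jet 4 g x t
      + calM5 k (of_real c) (of_real (l\<^sup>2)) M2 / 120 * jet 5 g x t" for g
    by (simp add: jet_comb_def lessThan_nat_numeral lessThan_Suc chain_coeffs_def add_ac)
  have "1 / (2 * of_real l ^ 2) * P x t = of_real (1 / (2 * l)) * L (\<lambda>w. 1) x t"
    using l by (simp add: P_def psi_def power2_eq_square)
  then show "ymu_vec A B k a1 a2 (of_real c) (of_real (l\<^sup>2)) l M1 M2 x t $ 1 = Q x t"
    by (simp add: ymu_vec_def Y_vec_jet E_der_jet Q_def psi_def N L_jets algebra_simps)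
  show "ymu_vec A B k a1 a2 (of_real c) (of_real (l\<^sup>2)) l M1 M2 x t $ 2 = G1 x t"
    "ymu_vec A B k a1 a2 (of_real c) (of_real (l\<^sup>2)) l M1 M2 x t $ 3 = G2 x t"
    by (simp_all add: ymu_vec_def Y_vec_jet G1_def G2_def phi1_def phi2_def N algebra_simps)
qed

text \<open>The null constraint is the expansion of <y_R|J|y_R> = 0 for a real symmetric Gram matrix
  with g00 = g01 = 0.\<close>

lemma null: "P x t * cnj (P x t) = F1 x t * cnj (F1 x t) + F2 x t * cnj (F2 x t)"
proof -
  let ?G = "\<lambda>i j. jet_pairing i j x t" and ?g = "gram A B k a1 a2 (of_real c) l"
  have comps: "P x t = l * jet 0 (\<lambda>w. 1) x t + M1 * (l * jet 1 (\<lambda>w. 1) x t) + M2 / 2 * (l * jet 2 (\<lambda>w. 1) x t)"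
    "F1 x t = U1 x t * jet 0 (h1 k) x t + M1 * (U1 x t * jet 1 (h1 k) x t) + M2 / 2 * (U1 x t * jet 2 (h1 k) x t)"
    "F2 x t = U2 x t * jet 0 (h2 k) x t + M1 * (U2 x t * jet 1 (h2 k) x t) + M2 / 2 * (U2 x t * jet 2 (h2 k) x t)"
    by (simp_all add: P_def F1_def F2_def psi_def phi1_def phi2_def L_jets algebra_simps)
  have sym: "?G i j = cnj (?G j i)" for i j
    by (simp add: jet_pairing_def cnj_pairing)
  have G: "?G 0 0 = 0" "?G 0 1 = 0" "?G 1 0 = 0" "?G 0 2 = of_real (?g 0 2)" "?G 2 0 = of_real (?g 0 2)"
    "?G 1 1 = of_real (?g 1 1)" "?G 1 2 = of_real (?g 1 2)" "?G 2 1 = of_real (?g 1 2)" "?G 2 2 = of_real (?g 2 2)"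
    using sym[of 1 0] sym[of 2 0] sym[of 2 1] by (simp_all add: jet_pairing_0[unfolded One_nat_def] jet_pairing_gram)
  have "pairing (P x t) (F1 x t) (F2 x t) (P x t) (F1 x t) (F2 x t)
      = ?G 0 0 + M1 * ?G 0 1 + M2 / 2 * ?G 0 2
        + cnj M1 * (?G 1 0 + M1 * ?G 1 1 + M2 / 2 * ?G 1 2)
        + cnj (M2 / 2) * (?G 2 0 + M1 * ?G 2 1 + M2 / 2 * ?G 2 2)"
    unfolding comps pairing_comb3 jet_pairing_def ..
  also have "\<dots> = of_real (?g 1 1) * (M1 * cnj M1) + of_real (?g 0 2) * ((M2 + cnj M2) / 2)
      + of_real (?g 1 2) * ((cnj M1 * M2 + cnj (cnj M1 * M2)) / 2) + of_real (?g 2 2) / 4 * (M2 * cnj M2)"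
    unfolding G by (simp add: algebra_simps add_divide_distrib)
  also have "\<dots> = of_real (?g 1 1 * (cmod M1)\<^sup>2 + ?g 0 2 * Re M2
      + Re (of_real (?g 1 2) * cnj M1 * M2) + ?g 2 2 / 4 * (cmod M2)\<^sup>2)"
    unfolding complex_add_cnj complex_norm_square[symmetric] by (simp add: mult.assoc)
  also have "\<dots> = 0"
    unfolding null_constraint by simp
  finally show ?thesis
    by (simp add: pairing_def mult.commute diff_diff_eq)
qed

text \<open>Nonsingularity: if \<open>y\<^sub>R\<close> vanished at a point, the first-order functional
  \<open>g \<mapsto> M1 * jet 0 g + M2 * jet 1 g\<close> would annihilate \<open>1\<close> and \<open>h1\<close>, forcing \<open>M1 = M2 = 0\<close>.\<close>

lemma P_nonzero: "P x t \<noteq> 0"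
proof
  assume P: "P x t = 0"
  then have "of_real ((cmod (F1 x t))\<^sup>2 + (cmod (F2 x t))\<^sup>2) = complex_of_real 0"
    using null[of x t] by (simp only: of_real_add complex_norm_square) simp
  then have F: "F1 x t = 0" "F2 x t = 0"
    by (simp_all only: of_real_eq_iff) (simp_all add: sum_power2_eq_zero_iff)
  have "A \<noteq> 0" "B \<noteq> 0"
    unfolding A B using c k kc_nonzero by auto
  then have U: "U1 x t \<noteq> 0" "U2 x t \<noteq> 0"
    using cnj_U[of x t] by auto
  have L1: "L (\<lambda>w. 1) x t = 0" and Lh: "L (h1 k) x t = 0" "L (h2 k) x t = 0"
    using P F U l by (simp_all add: P_def F1_def F2_def psi_def phi1_def phi2_def)
  \<comment> \<open>The psi-equation in x expresses w through 1, \<open>h1\<close> and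
    \<open>h2\<close> modulo the cubic, so L annihilates w too.\<close>
  have "of_real (l\<^sup>2) * L (\<lambda>w. w) x t = 0"
    unfolding comb_spectral_x defect_3[unfolded defect_x_def] L1 Lh by simp
  then have Lw: "L (\<lambda>w. w) x t = 0"
    using l by simp
  have lower: "L (\<lambda>w. w * g w) x t = of_real c * L g x t + (M1 * jet 0 g x t + M2 * jet 1 g x t)"
    if g: "g holomorphic_on S" for g
  proof -
    have "L (\<lambda>w. w * g w) x t = L (\<lambda>w. of_real c * g w + (w - of_real c) * g w) x t"
      using g by (intro jet_comb_cong) (auto intro!: holomorphic_intros simp: algebra_simps)
    also have "\<dots> = of_real c * L g x t + L (\<lambda>w. (w - of_real c) * g w) x t"
      using g by (simp only: jet_comb_add jet_comb_cmult holomorphic_intros)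
    also have "L (\<lambda>w. (w - of_real c) * g w) x t = M1 * jet 0 g x t + M2 * jet 1 g x t"
      using g by (simp add: numeral_3_eq_3 jet_comb_lower)
        (simp add: jet_comb_def dressing_coeffs_def eval_nat_numeral)
    finally show ?thesis .
  qed
  have i: "M1 * jet 0 (\<lambda>w. 1) x t + M2 * jet 1 (\<lambda>w. 1) x t = 0"
    using lower[of "\<lambda>w. 1"] Lw L1 by simp
  have ii: "M1 * jet 0 (h1 k) x t + M2 * jet 1 (h1 k) x t = 0"
    using lower[of "h1 k"] Lh by (simp add: comb_ident_h1 L1)
  have e: "jet 0 (\<lambda>w. 1) x t \<noteq> 0" "jet 0 (h1 k) x t \<noteq> 0"
    using c_in_S S_nonzero(2) k by (simp_all add: jet_0 h1_def)
  \<comment> \<open>By \<open>jet_h1\<close> for n = 0 and 1, k + c times \<open>ii\<close> equals k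
    times \<open>i\<close> minus M2 times the zeroth jet of \<open>h1\<close>.\<close>
  have "M2 * jet 0 (h1 k) x t = 0"
    using i ii jet_h1[of 0 x t] jet_h1[of 1 x t] by simp algebra
  then have M2: "M2 = 0"
    using e by simp
  then have "M1 = 0"
    using i e by simp
  then show False
    using L1 M2 e unfolding L_jets by simp
qed

lemma elementary_components:
  "elementary_field U1" "elementary_field U2" "elementary_field P" "elementary_field F1"
  "elementary_field F2" "elementary_field Q" "elementary_field G1" "elementary_field G2"
proof -
  have U: "elementary_field U1" "elementary_field U2"
    unfolding U1_def U2_def u10_def[abs_def] u20_def[abs_def] of_real_add of_real_mult
    by (intro elementary_intros)+
  have comb: "elementary_field (psi d q)" "elementary_field (phi1 d q)" "elementary_field (phi2 d q)" for d q
    unfolding psi_def[abs_def] phi1_def[abs_def] phi2_def[abs_def]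
    by (intro elementary_const elementary_mult U elementary_jet_comb holo holomorphic_intros)+
  show "elementary_field U1" "elementary_field U2" "elementary_field P" "elementary_field F1"
    "elementary_field F2" "elementary_field Q" "elementary_field G1" "elementary_field G2"
    unfolding P_def F1_def F2_def G1_def G2_def Q_def[abs_def]
    by (intro U comb elementary_add elementary_mult elementary_const)+
qed

section \<open>Lax equations for y_R and for the chain vector y_mu\<close>

lemma P_x: "((\<lambda>s. P s t) has_vector_derivative
    (cnj (V1 x t) * F1 x t + cnj (V2 x t) * F2 x t) / l + 2 * \<i> / (of_real l)\<^sup>2 * P x t) (at x)"
  using psi_x[of 3 "dressing_coeffs M1 M2" t x] by (simp add: P_def F1_def F2_def defect_3)

lemma P_t: "((\<lambda>s. P x s) has_vector_derivative
    \<i> / 2 * ((U1 x t * cnj (U1 x t) + U2 x t * cnj (U2 x t)) * P x t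
      + l * lax_e l (U1 x t) (U2 x t) (P x t) (F1 x t) (F2 x t))) (at t)"
  using psi_t[of 3 "dressing_coeffs M1 M2" x t] by (simp add: P_def F1_def F2_def defect_3)

lemma F_t: "((\<lambda>s. F1 x s) has_vector_derivative
    \<i> / 2 * lax_e l (U1 x t) (U2 x t) (P x t) (F1 x t) (F2 x t) * U1 x t) (at t)"
  "((\<lambda>s. F2 x s) has_vector_derivative
    \<i> / 2 * lax_e l (U1 x t) (U2 x t) (P x t) (F1 x t) (F2 x t) * U2 x t) (at t)"
  using phi1_t[of 3 "dressing_coeffs M1 M2" x t] phi2_t[of 3 "dressing_coeffs M1 M2" x t]
  by (simp_all add: P_def F1_def F2_def defect_3)

lemma Q_x: "((\<lambda>s. Q s t) has_vector_derivative
    ((cnj (V1 x t) * G1 x t + cnj (V2 x t) * G2 x t) / l + 2 * \<i> / (of_real l)\<^sup>2 * Q x t)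
    + (- (cnj (V1 x t) * F1 x t + cnj (V2 x t) * F2 x t) / (2 * of_real l ^ 3)
       - 2 * \<i> / of_real l ^ 4 * P x t)) (at x)"
proof -
  let ?X = "cnj (V1 x t) * F1 x t + cnj (V2 x t) * F2 x t"
    and ?Y = "cnj (V1 x t) * G1 x t + cnj (V2 x t) * G2 x t"
    and ?q = "psi 6 (chain_coeffs M1 M2) x t"
  have "((\<lambda>s. P s t) has_vector_derivative l * (\<i> * L (\<lambda>w. w) x t)) (at x)"
    unfolding P_def psi_def using comb_x[of "\<lambda>w. 1" 3 "dressing_coeffs M1 M2" t x]
    by (intro has_vector_derivative_mult_right) simp
  \<comment> \<open>Two expressions for the x-derivative of \<open>P\<close> are equated, to rewrite
    L(w), and with it the chain defect, in Lax form.\<close>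
  from vector_derivative_unique_at[OF P_x this]
  have "of_real l * (\<i> * L (\<lambda>w. w) x t) = ?X / l + 2 * \<i> / (of_real l)\<^sup>2 * P x t" ..
  moreover have "defect_x 6 (chain_coeffs M1 M2) x t = - L (\<lambda>w. w) x t / of_real (l\<^sup>2)"
    using chain_defect_x[of M1 M2 x t] l by (simp add: field_simps)
  then have "\<i> * l * defect_x 6 (chain_coeffs M1 M2) x t = - (of_real l * (\<i> * L (\<lambda>w. w) x t)) / of_real l ^ 2"
    by simp
  ultimately have defect: "\<i> * l * defect_x 6 (chain_coeffs M1 M2) x t
      = - (?X / l + 2 * \<i> / (of_real l)\<^sup>2 * P x t) / of_real l ^ 2"
    by simp
  have D: "((\<lambda>s. Q s t) has_vector_derivative
      ((?Y / l + 2 * \<i> / (of_real l)\<^sup>2 * ?q) + \<i> * l * defect_x 6 (chain_coeffs M1 M2) x t)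
      + 1 / (2 * of_real l ^ 2) * (?X / l + 2 * \<i> / (of_real l)\<^sup>2 * P x t)) (at x)"
    unfolding Q_def G1_def G2_def
    by (intro has_vector_derivative_add has_vector_derivative_mult_right psi_x P_x)
  \<comment> \<open>The defect contributes -P_x/l^2 and the extra summand of \<open>Q\<close>
    contributes P_x/(2 l^2); completing psi to \<open>Q\<close> in the homogeneous term moves a
    further i P/l^4.\<close>
  have collect: "((y + 2 * \<i> / b\<^sup>2 * q) + - (X / b + 2 * \<i> / b\<^sup>2 * p) / b ^ 2)
        + 1 / (2 * b ^ 2) * (X / b + 2 * \<i> / b\<^sup>2 * p)
      = (y + 2 * \<i> / b\<^sup>2 * (q + 1 / (2 * b ^ 2) * p)) + (- X / (2 * b ^ 3) - 2 * \<i> / b ^ 4 * p)"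
    if "b \<noteq> 0" for b X y q p :: complex
    using that by (simp add: field_simps power2_eq_square power3_eq_cube power4_eq_xxxx)
  have "complex_of_real l \<noteq> 0"
    using l by simp
  from has_vector_derivative_eq_rhs[OF D[unfolded defect] collect[OF this]] show ?thesis
    by (simp only: Q_def)
qed

lemma chain_defect_t_eq: "\<i> * of_real l ^ 2 * defect_t 6 (chain_coeffs M1 M2) x t = - \<i> * P x t / l"
proof -
  have "\<i> * of_real l ^ 2 * defect_t 6 (chain_coeffs M1 M2) x t
      = \<i> * (of_real (l\<^sup>2) * defect_t 6 (chain_coeffs M1 M2) x t)"
    by simp
  also have "\<dots> = - \<i> * P x t / l"
    unfolding chain_defect_t P_def psi_def using l by simp
  finally show ?thesis .
qed

lemma lax_e_Q: "lax_e l (U1 x t) (U2 x t) (Q x t) (G1 x t) (G2 x t)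
    = lax_e l (U1 x t) (U2 x t) (psi 6 (chain_coeffs M1 M2) x t) (G1 x t) (G2 x t) + P x t / (2 * l)"
  using l by (simp add: lax_e_def Q_def distrib_left power2_eq_square)

lemma Q_t: "((\<lambda>s. Q x s) has_vector_derivative
    \<i> / 2 * ((U1 x t * cnj (U1 x t) + U2 x t * cnj (U2 x t)) * Q x t
      + l * lax_e l (U1 x t) (U2 x t) (Q x t) (G1 x t) (G2 x t))
    + (\<i> / 2 * P x t - \<i> / (4 * of_real l) * (cnj (U1 x t) * F1 x t + cnj (U2 x t) * F2 x t))) (at t)"
proof -
  let ?X = "cnj (U1 x t) * F1 x t + cnj (U2 x t) * F2 x t"
    and ?N = "U1 x t * cnj (U1 x t) + U2 x t * cnj (U2 x t)"
    and ?q = "psi 6 (chain_coeffs M1 M2) x t"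
  let ?e = "lax_e l (U1 x t) (U2 x t) ?q (G1 x t) (G2 x t)"
  have "\<i> * of_real l ^ 3 / 2 * defect_t 6 (chain_coeffs M1 M2) x t
      = l / 2 * (\<i> * of_real l ^ 2 * defect_t 6 (chain_coeffs M1 M2) x t)"
    by (simp add: power2_eq_square power3_eq_cube)
  also have "\<dots> = - \<i> / 2 * P x t"
    unfolding chain_defect_t_eq using l by simp
  finally have defect: "\<i> * of_real l ^ 3 / 2 * defect_t 6 (chain_coeffs M1 M2) x t = - \<i> / 2 * P x t" .
  have D: "((\<lambda>s. Q x s) has_vector_derivative
      (\<i> / 2 * (?N * ?q + l * ?e) - \<i> * of_real l ^ 3 / 2 * defect_t 6 (chain_coeffs M1 M2) x t)
      + 1 / (2 * of_real l ^ 2) * (\<i> / 2 * (?N * P x t + l * lax_e l (U1 x t) (U2 x t) (P x t) (F1 x t) (F2 x t)))) (at t)"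
    unfolding Q_def G1_def G2_def
    by (intro has_vector_derivative_add has_vector_derivative_mult_right psi_t P_t)
  have collect: "(\<i> / 2 * (n * q + b * y) - (- \<i> / 2 * p)) + 1 / (2 * b ^ 2) * (\<i> / 2 * (n * p + b * (b * p - X)))
      = \<i> / 2 * (n * (q + 1 / (2 * b ^ 2) * p) + b * (y + p / (2 * b))) + (\<i> / 2 * p - \<i> / (4 * b) * X)"
    if "b \<noteq> 0" for b X y q p n :: complex
    using that by (simp add: field_simps power2_eq_square)
  have "complex_of_real l \<noteq> 0"
    using l by simp
  from has_vector_derivative_eq_rhs[OF D[unfolded defect lax_e_def[of l _ _ "P x t"]] collect[OF this]]
  show ?thesis
    unfolding lax_e_Q by (simp only: Q_def of_real_mult of_real_numeral)
qed

text \<open>There is no spatial defect in the lower components; the inhomogeneity comes solely from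
  completing psi to \<open>Q\<close>.\<close>

lemma G_x: "((\<lambda>s. G1 s t) has_vector_derivative V1 x t * Q x t / l + (- V1 x t * P x t / (2 * of_real l ^ 3))) (at x)"
  "((\<lambda>s. G2 s t) has_vector_derivative V2 x t * Q x t / l + (- V2 x t * P x t / (2 * of_real l ^ 3))) (at x)"
proof -
  have collect: "v * q / l = v * (q + 1 / (2 * of_real l ^ 2) * p) / l + (- v * p / (2 * of_real l ^ 3))"
    for v q p :: complex
    using l by (simp add: field_simps power2_eq_square power3_eq_cube)
  show "((\<lambda>s. G1 s t) has_vector_derivative V1 x t * Q x t / l + (- V1 x t * P x t / (2 * of_real l ^ 3))) (at x)"
    "((\<lambda>s. G2 s t) has_vector_derivative V2 x t * Q x t / l + (- V2 x t * P x t / (2 * of_real l ^ 3))) (at x)"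
    unfolding G1_def G2_def Q_def
    by (rule has_vector_derivative_eq_rhs[OF phi1_x collect] has_vector_derivative_eq_rhs[OF phi2_x collect])+
qed

text \<open>The defect contributes i u P/(2 l). Half of it is absorbed when the bracket
  \<open>lax_e\<close> is completed from psi to \<open>Q\<close>, the other half is the
  inhomogeneity.\<close>

lemma G_t: "((\<lambda>s. G1 x s) has_vector_derivative
    \<i> / 2 * lax_e l (U1 x t) (U2 x t) (Q x t) (G1 x t) (G2 x t) * U1 x t
    + \<i> / (4 * of_real l) * U1 x t * P x t) (at t)"
  "((\<lambda>s. G2 x s) has_vector_derivative
    \<i> / 2 * lax_e l (U1 x t) (U2 x t) (Q x t) (G1 x t) (G2 x t) * U2 x t
    + \<i> / (4 * of_real l) * U2 x t * P x t) (at t)"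
proof -
  let ?e = "lax_e l (U1 x t) (U2 x t) (psi 6 (chain_coeffs M1 M2) x t) (G1 x t) (G2 x t)"
    and ?d = "defect_t 6 (chain_coeffs M1 M2) x t"
  have collect: "\<i> / 2 * ?e * u - \<i> * (of_real l)\<^sup>2 / 2 * u * ?d
      = \<i> / 2 * (?e + P x t / (2 * l)) * u + \<i> / (4 * of_real l) * u * P x t" for u
  proof -
    have "\<i> * (of_real l)\<^sup>2 / 2 * u * ?d = u / 2 * (\<i> * of_real l ^ 2 * ?d)"
      by simp
    also have "\<dots> = - \<i> * P x t * u / (2 * of_real l)"
      unfolding chain_defect_t_eq by simp
    finally have d: "\<i> * (of_real l)\<^sup>2 / 2 * u * ?d = - \<i> * P x t * u / (2 * of_real l)" .
    show ?thesis
      unfolding d using l by (simp add: field_simps)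
  qed
  show "((\<lambda>s. G1 x s) has_vector_derivative
      \<i> / 2 * lax_e l (U1 x t) (U2 x t) (Q x t) (G1 x t) (G2 x t) * U1 x t
      + \<i> / (4 * of_real l) * U1 x t * P x t) (at t)"
    unfolding lax_e_Q collect[symmetric] unfolding G1_def G2_def by (rule phi1_t)
  show "((\<lambda>s. G2 x s) has_vector_derivative
      \<i> / 2 * lax_e l (U1 x t) (U2 x t) (Q x t) (G1 x t) (G2 x t) * U2 x t
      + \<i> / (4 * of_real l) * U2 x t * P x t) (at t)"
    unfolding lax_e_Q collect[symmetric] unfolding G1_def G2_def by (rule phi2_t)
qed

sublocale lax_chain U1 U2 V1 V2 P F1 F2 Q G1 G2 l zeta
  "\<lambda>x t. U1 x t * cnj (U1 x t) + U2 x t * cnj (U2 x t)"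
  "\<lambda>x t. cnj (U1 x t) * V1 x t + cnj (U2 x t) * V2 x t"
  "\<lambda>x t. lax_e l (U1 x t) (U2 x t) (P x t) (F1 x t) (F2 x t)"
  "\<lambda>x t. lax_e l (U1 x t) (U2 x t) (Q x t) (G1 x t) (G2 x t)"
  using l zeta P_nonzero U_x V_t P_x P_t F_t Q_x Q_t G_x G_t null
    phi1_x[of 3 "dressing_coeffs M1 M2", folded P_def F1_def]
    phi2_x[of 3 "dressing_coeffs M1 M2", folded P_def F2_def]
  by unfold_locales auto

text \<open>Nullity makes the upper and lower components contribute equally; thus the K-term of
  \<open>m_zeta\<close> becomes the |p|^2 / l of the chain locale.\<close>

lemma hermitian_yR: "hermitian_dot (yR_vec A B k a1 a2 (of_real c) l M1 M2 x t) (yR_vec A B k a1 a2 (of_real c) l M1 M2 x t)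
    = 2 * (P x t * cnj (P x t))"
  using null[of x t] by (simp add: hermitian_dot_def sum_3 yR_components mult.commute)

lemma m_zeta_eq: "m_zeta zeta l (yR_vec A B k a1 a2 (of_real c) l M1 M2 x t)
    (ymu_vec A B k a1 a2 (of_real c) (of_real (l\<^sup>2)) l M1 M2 x t) = m x t"
proof -
  have "cnj (Omega x t) = pairing (P x t) (F1 x t) (F2 x t) (Q x t) (G1 x t) (G2 x t)"
    by (simp add: Omega_def cnj_pairing)
  then show ?thesis
    unfolding m_zeta_def m_def braket_K hermitian_yR
    by (simp add: braket_J yR_components ymu_components Omega_def del: of_real_power)
qed

lemma elementary_m: "elementary_field m"
  unfolding m_def[abs_def] Omega_def[abs_def] pairing_def[abs_def] divide_inverse[of _ "of_real l"]
  by (intro elementary_components elementary_add elementary_mult elementary_const elementary_cnj elementary_diff)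

lemma Re_m: "of_real (Re (m x t)) = - (P x t * cnj (P x t)) / l"
proof -
  have "l * (2 * of_real (Re (m x t))) = - 2 * (P x t * cnj (P x t))"
    using m_re[of x t] by (simp add: complex_add_cnj)
  then show ?thesis
    using l by (simp add: field_simps)
qed

lemma Re_m_neg: "Re (m x t) < 0"
proof -
  have "complex_of_real (Re (m x t)) = of_real (- (cmod (P x t))\<^sup>2 / l)"
    unfolding Re_m complex_norm_square[symmetric] by simp
  then have "Re (m x t) = - (cmod (P x t))\<^sup>2 / l"
    by (simp only: of_real_eq_iff)
  then show ?thesis
    using l P_nonzero[of x t] by (simp add: zero_less_divide_iff)
qed

end

theorem theorem36:
  fixes A B k a1 a2 lambda0 :: real
    and chi0 mu0 M1 M2 zeta :: complex
    and g :: "nat \<Rightarrow> nat \<Rightarrow> real"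
    and Y :: "nat \<Rightarrow> real \<Rightarrow> real \<Rightarrow> complex^3"
    and yR ymu :: "real \<Rightarrow> real \<Rightarrow> complex^3"
    and m u1 u2 :: "real \<Rightarrow> real \<Rightarrow> complex"
  defines "lambda0 \<equiv> sqrt (Re mu0)"
    and "g \<equiv> gram A B k a1 a2 chi0 lambda0"
    and "Y \<equiv> Y_vec A B k a1 a2 chi0 lambda0"
    and "yR \<equiv> yR_vec A B k a1 a2 chi0 lambda0 M1 M2"
    and "ymu \<equiv> ymu_vec A B k a1 a2 chi0 mu0 lambda0 M1 M2"
    and "m \<equiv> (\<lambda>x t. m_zeta zeta lambda0 (yR x t) (ymu x t))"
    and "u1 \<equiv> (\<lambda>x t. u10 A k a1 x t + 2 * cnj (yR x t $ 1) / m x t * (yR x t $ 2))"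
    and "u2 \<equiv> (\<lambda>x t. u20 B k a2 x t + 2 * cnj (yR x t $ 1) / m x t * (yR x t $ 3))"
  assumes "A > 0" and "B > 0" and "k \<noteq> 0"
    and "a1\<^sup>2 = A" and "a2\<^sup>2 = B"
    and triple_root: "\<forall>chi. spatial_cubic A B k chi mu0 = mu0 * (chi - chi0) ^ 3"
    and null_constraint:
      "g 1 1 * (cmod M1)\<^sup>2 + g 0 2 * Re M2 + Re (complex_of_real (g 1 2) * cnj M1 * M2)
         + g 2 2 / 4 * (cmod M2)\<^sup>2 = 0"
    and "zeta \<notin> \<real>"
  shows
    "(chi0 \<in> \<real> \<and> 0 < Re chi0 \<and> Re chi0 < \<bar>k\<bar> \<and> mu0 = 2 / (3 * chi0) \<and>
      lambda0 > 0 \<and> mu0 = complex_of_real (lambda0\<^sup>2) \<and>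
      (\<forall>i\<le>2. \<forall>j\<le>2. \<forall>x t. braket (Y i x t) J_mat (Y j x t) = complex_of_real (g i j))) \<and>
     (\<forall>x t. complex_of_real (Re (m x t))
              = - (hermitian_dot (yR x t) (yR x t) / complex_of_real (2 * lambda0))
            \<and> Re (m x t) < 0) \<and>
     (\<forall>x t. m x t \<noteq> 0) \<and> smooth_on_plane u1 \<and> smooth_on_plane u2 \<and> coupled_FL_solution u1 u2"
proof -
  obtain c where chi0: "chi0 = of_real c" and c: "0 < c" "c < \<bar>k\<bar>" and mu0: "mu0 = of_real (2 / (3 * c))"
    and AB: "A = (k + c) ^ 3 / (3 * c * k ^ 3)" "B = (k - c) ^ 3 / (3 * c * k ^ 3)"
    using triple_root_parameters[OF assms(9-11)] triple_root by blast
  \<comment> \<open>mu0 is real and positive, so the square root of its real part is a genuine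
    square root of mu0.\<close>
  have l2: "lambda0\<^sup>2 = 2 / (3 * c)" and l: "0 < lambda0"
    using c by (simp_all add: lambda0_def mu0)
  have mu0_l: "mu0 = of_real (lambda0\<^sup>2)"
    unfolding l2 by (rule mu0)
  interpret dr: triple_root_dressing A B k a1 a2 c lambda0 M1 M2 zeta
    using assms(9-13) \<open>zeta \<notin> \<real>\<close> c l l2 AB triple_root null_constraint
    unfolding mu0_l chi0 g_def by unfold_locales auto
  note yR = yR_def[unfolded chi0] and ymu = ymu_def[unfolded chi0 mu0_l]
  have m: "m x t = dr.m x t" for x t
    unfolding m_def yR ymu by (rule dr.m_zeta_eq)
  have u1: "u1 = (\<lambda>x t. dr.U1 x t + 2 * cnj (dr.P x t) / dr.m x t * dr.F1 x t)"
    and u2: "u2 = (\<lambda>x t. dr.U2 x t + 2 * cnj (dr.P x t) / dr.m x t * dr.F2 x t)"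
    unfolding u1_def u2_def m yR dr.yR_components by (simp_all add: dr.U1_def dr.U2_def)
  have "elementary_field u1" "elementary_field u2"
    unfolding u1 u2
    by (intro elementary_add elementary_mult elementary_divide elementary_cnj elementary_const
        dr.elementary_components dr.elementary_m dr.m_nonzero)+
  then have "smooth_on_plane u1" "smooth_on_plane u2"
    by (simp_all add: elementary_smooth)
  moreover have "coupled_FL_solution u1 u2"
    unfolding u1 u2 by (rule dr.solution)
  moreover have "complex_of_real (Re (m x t))
      = - (hermitian_dot (yR x t) (yR x t) / complex_of_real (2 * lambda0))" for x t
    unfolding m dr.Re_m yR dr.hermitian_yR by simp
  moreover have "Re (m x t) < 0" "m x t \<noteq> 0" for x t
    unfolding m by (rule dr.Re_m_neg dr.m_nonzero)+
  moreover have "braket (Y i x t) J_mat (Y j x t) = complex_of_real (g i j)"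
    if "i \<le> 2" "j \<le> 2" for i j x t
    unfolding Y_def g_def chi0 dr.braket_Y by (rule dr.jet_pairing_gram[OF that])
  moreover have "chi0 \<in> \<real>" "0 < Re chi0" "Re chi0 < \<bar>k\<bar>" "mu0 = 2 / (3 * chi0)"
    using c by (simp_all add: chi0 mu0)
  ultimately show ?thesis
    using l mu0_l by blast
qed

end
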